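(* Let $B$ be a unital Banach algebra over $\mathbb{C}$, let $\theta\in B^d$ with $\theta(1)=1$, and let $C_\theta=D_\theta^*\circ D$. Then $$\ker(D|_{\mathcal{Z}(B^d)})=\ker(C_\theta|_{\mathcal{Z}(B^d)})=\mathcal{Z}(1^\perp)+[\mathcal{Z}(B^d),\mathcal{Z}(B^d)].$$
   Context: $B^d$ is the topological dual of $B$; $M_n(B)=M_n(\mathbb{C})\otimes B$ with its natural topology; $M(B)=(M_n(B))_{n\ge1}$. $A(M(B))$ is the unital algebra (levelwise operations) of families $f=(f_n)_{n\ge1}$ of analytic maps $f_n:M_n(B)\to M_n(\mathbb{C})$ with $f_{m+n}(\beta\oplus\beta')=f_m(\beta)\oplus f_n(\beta')$ and $f_n((s\otimes1)\beta(s\otimes1)^{-1})=sf_n(\beta)s^{-1}$ for $s\in GL_n(\mathbb{C})$. For $\varphi\in B^d$, $z(\varphi)\in A(M(B))$ is $z(\varphi)_n=\mathrm{id}_{M_n(\mathbb{C})}\otimes\varphi$ (apply $\varphi$ entrywise). $\mathcal{Z}(B^d)$ is the unital subalgebra of $A(M(B))$ generated by $\{z(\varphi):\varphi\in B^d\}$, and $\mathcal{Z}(1^\perp)$ the unital subalgebra generated by $\{z(\varphi):\varphi\in B^d,\ \varphi(1)=0\}$. $[\mathcal{Z}(B^d),\mathcal{Z}(B^d)]$ is the linear span of commutators. $\partial f$ for $f\in A(M(B))$ is given by $$(\partial f)_{m;n}(\beta;\beta')=\sum_{1\le a,b\le m,\,1\le c,d\le n}\Big(\tfrac{d}{d\epsilon}f_{m+n}\big(\left[\begin{smallmatrix}\beta&\epsilon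 e^{(m,n)}_{b,c}\otimes1\\0&\beta'\end{smallmatrix}\right]\big)\big|_{\epsilon=0}\Big)_{(a,m+d)}e^{(m)}_{a,b}\otimes e^{(n)}_{c,d}\in M_m(\mathbb{C})\otimes M_n(\mathbb{C})$$ ($e$'s are matrix units). The cyclic derivative $D:A(M(B))\to A(M(B))$ is $(Df)_n(\beta)=\mathrm{mult}(\sigma((\partial f)_{n;n}(\beta;\beta)))$, with $\sigma(a\otimes b)=b\otimes a$, $\mathrm{mult}(a\otimes b)=ab$. On monomials, $D[z(\varphi_1)\cdots z(\varphi_k)]=\sum_{i=1}^k\varphi_i(1)z(\varphi_{i+1})\cdots z(\varphi_k)z(\varphi_1)\cdots z(\varphi_{i-1})$, so $D$ maps $\mathcal{Z}(B^d)$ into itself. $D_\theta^*[f]=f\,z(\theta)$. *)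

theory Defs
  imports "HOL-Analysis.Derivative" "HOL-Library.FuncSet" "HOL.Hull" "Jordan_Normal_Form.Matrix"
begin

section \<open>Complex unital Banach algebras and their duals\<close>

text \<open>The complex scalar multiplication extends the real one of \<^class>\<open>banach\<close>. The norm is
  submultiplicative; \<open>norm 1 = 1\<close> is not required.\<close>

class complex_unital_banach_algebra = real_normed_algebra + ring_1 + banach +
  fixes scaleC :: "complex \<Rightarrow> 'a \<Rightarrow> 'a"  (infixr \<open>*\<^sub>C\<close> 75)
  assumes scaleC_add_right: "c *\<^sub>C (x + y) = c *\<^sub>C x + c *\<^sub>C y"
    and scaleC_add_left: "(c + d) *\<^sub>C x = c *\<^sub>C x + d *\<^sub>C x"
    and scaleC_scaleC: "c *\<^sub>C d *\<^sub>C x = (c * d) *\<^sub>C x"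
    and scaleC_of_real: "of_real r *\<^sub>C x = r *\<^sub>R x"
    and mult_scaleC_left: "(c *\<^sub>C x) * y = c *\<^sub>C (x * y)"
    and mult_scaleC_right: "x * (c *\<^sub>C y) = c *\<^sub>C (x * y)"
    and norm_scaleC: "norm (c *\<^sub>C x) = cmod c * norm x"

definition top_dual :: "('b::complex_unital_banach_algebra \<Rightarrow> complex) set" where
  "top_dual = {\<phi>. bounded_linear \<phi> \<and> (\<forall>c x. \<phi> (c *\<^sub>C x) = c * \<phi> x)}"


section \<open>Matrices over a Banach algebra\<close>

text \<open>\<open>M\<^sub>n(B)\<close> is \<^term>\<open>carrier_mat n n :: 'b::complex_unital_banach_algebra mat set\<close>; matrix
  indices start at 0.\<close>

definition scal :: "complex mat \<Rightarrow> 'b::complex_unital_banach_algebra mat" where  \<comment> \<open>\<open>s \<mapsto> s \<otimes> 1\<close>\<close>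
  "scal s = map_mat (\<lambda>c. c *\<^sub>C 1) s"

definition dsum :: "'a::zero mat \<Rightarrow> 'a mat \<Rightarrow> 'a mat"  (infixr \<open>\<oplus>\<^sub>m\<close> 65) where
  "A \<oplus>\<^sub>m B = four_block_mat A (0\<^sub>m (dim_row A) (dim_col B)) (0\<^sub>m (dim_row B) (dim_col A)) B"

definition mat_unit :: "nat \<Rightarrow> nat \<Rightarrow> nat \<Rightarrow> nat \<Rightarrow> complex mat" where
  "mat_unit m n b c = mat m n (\<lambda>(i, j). if i = b \<and> j = c then 1 else 0)"

text \<open>A norm inducing the natural (entrywise) topology on \<open>M\<^sub>n(B)\<close> and \<open>M\<^sub>n(\<complex>)\<close>.\<close>

definition entry_norm :: "'a::real_normed_vector mat \<Rightarrow> real" where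
  "entry_norm A = (\<Sum>i<dim_row A. \<Sum>j<dim_col A. norm (A $$ (i, j)))"

definition bounded_clinear_mat ::
    "nat \<Rightarrow> ('b::complex_unital_banach_algebra mat \<Rightarrow> complex mat) \<Rightarrow> bool" where
  "bounded_clinear_mat n L \<longleftrightarrow>
     L \<in> carrier_mat n n \<rightarrow> carrier_mat n n \<and>
     (\<forall>H\<in>carrier_mat n n. \<forall>K\<in>carrier_mat n n. L (H + K) = L H + L K) \<and>
     (\<forall>c. \<forall>H\<in>carrier_mat n n. L (map_mat ((*\<^sub>C) c) H) = c \<cdot>\<^sub>m L H) \<and>
     (\<exists>C. \<forall>H\<in>carrier_mat n n. entry_norm (L H) \<le> C * entry_norm H)"

text \<open>A map between complex Banach spaces is analytic iff it is complex Frechet differentiable at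
  each point of its open domain, here all of \<open>M\<^sub>n(B)\<close>.\<close>

definition analytic_mat ::
    "nat \<Rightarrow> ('b::complex_unital_banach_algebra mat \<Rightarrow> complex mat) \<Rightarrow> bool" where
  "analytic_mat n F \<longleftrightarrow>
     (\<forall>\<beta>\<in>carrier_mat n n. \<exists>L. bounded_clinear_mat n L \<and>
        (\<forall>e>0. \<exists>d>0. \<forall>H\<in>carrier_mat n n. entry_norm H < d \<longrightarrow>
           entry_norm (F (\<beta> + H) - F \<beta> - L H) \<le> e * entry_norm H))"


section \<open>The algebra \<open>A(M(B))\<close>\<close>

text \<open>Families are extensional functions on \<open>n \<ge> 1\<close> and \<open>\<beta> \<in> M\<^sub>n(B)\<close>, so that equality of families
  is equality in HOL.\<close>

type_synonym 'b family = "nat \<Rightarrow> 'b mat \<Rightarrow> complex mat"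

abbreviation family :: "(nat \<Rightarrow> 'b mat \<Rightarrow> complex mat) \<Rightarrow> 'b family" where
  "family F \<equiv> (\<lambda>n\<in>{1..}. \<lambda>\<beta>\<in>carrier_mat n n. F n \<beta>)"

definition AM :: "'b::complex_unital_banach_algebra family set" where
  "AM = {f \<in> (\<Pi>\<^sub>E n\<in>{1..}. carrier_mat n n \<rightarrow>\<^sub>E carrier_mat n n).
     (\<forall>n\<ge>1. analytic_mat n (f n)) \<and>
     (\<forall>m\<ge>1. \<forall>n\<ge>1. \<forall>\<beta>\<in>carrier_mat m m. \<forall>\<beta>'\<in>carrier_mat n n.
        f (m + n) (\<beta> \<oplus>\<^sub>m \<beta>') = f m \<beta> \<oplus>\<^sub>m f n \<beta>') \<and>
     (\<forall>n\<ge>1. \<forall>s\<in>carrier_mat n n. \<forall>t\<in>carrier_mat n n. s * t = 1\<^sub>m n \<and> t * s = 1\<^sub>m n \<longrightarrow>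
        (\<forall>\<beta>\<in>carrier_mat n n. f n (scal s * \<beta> * scal t) = s * f n \<beta> * t))}"

definition fam_zero :: "'b family" where
  "fam_zero = family (\<lambda>n \<beta>. 0\<^sub>m n n)"

definition fam_one :: "'b family" where
  "fam_one = family (\<lambda>n \<beta>. 1\<^sub>m n)"

definition fam_add :: "'b family \<Rightarrow> 'b family \<Rightarrow> 'b family" where
  "fam_add f g = family (\<lambda>n \<beta>. f n \<beta> + g n \<beta>)"

definition fam_diff :: "'b family \<Rightarrow> 'b family \<Rightarrow> 'b family" where
  "fam_diff f g = family (\<lambda>n \<beta>. f n \<beta> - g n \<beta>)"

definition fam_mult :: "'b family \<Rightarrow> 'b family \<Rightarrow> 'b family" where
  "fam_mult f g = family (\<lambda>n \<beta>. f n \<beta> * g n \<beta>)"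

definition fam_smult :: "complex \<Rightarrow> 'b family \<Rightarrow> 'b family" where
  "fam_smult c f = family (\<lambda>n \<beta>. c \<cdot>\<^sub>m f n \<beta>)"

definition linear_subspace :: "'b::complex_unital_banach_algebra family set \<Rightarrow> bool" where
  "linear_subspace V \<longleftrightarrow> V \<subseteq> AM \<and> fam_zero \<in> V \<and>
     (\<forall>f\<in>V. \<forall>g\<in>V. fam_add f g \<in> V) \<and> (\<forall>c. \<forall>f\<in>V. fam_smult c f \<in> V)"

definition unital_subalgebra :: "'b::complex_unital_banach_algebra family set \<Rightarrow> bool" where
  "unital_subalgebra V \<longleftrightarrow>
     linear_subspace V \<and> fam_one \<in> V \<and> (\<forall>f\<in>V. \<forall>g\<in>V. fam_mult f g \<in> V)"

definition subspace_sum :: "'b family set \<Rightarrow> 'b family set \<Rightarrow> 'b family set" where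
  "subspace_sum V W = {fam_add f g | f g. f \<in> V \<and> g \<in> W}"

definition commutator_span ::
    "'b::complex_unital_banach_algebra family set \<Rightarrow> 'b family set" where
  "commutator_span V =
     linear_subspace hull {fam_diff (fam_mult f g) (fam_mult g f) | f g. f \<in> V \<and> g \<in> V}"


section \<open>The subalgebras \<open>Z(B\<^sup>d)\<close> and \<open>Z(1\<^sup>\<bottom>)\<close>\<close>

definition zfam :: "('b \<Rightarrow> complex) \<Rightarrow> 'b family" where
  "zfam \<phi> = family (\<lambda>n \<beta>. map_mat \<phi> \<beta>)"

definition Z_dual :: "'b::complex_unital_banach_algebra family set" where
  "Z_dual = unital_subalgebra hull (zfam ` top_dual)"

definition Z_one_perp :: "'b::complex_unital_banach_algebra family set" where
  "Z_one_perp = unital_subalgebra hull (zfam ` {\<phi> \<in> top_dual. \<phi> 1 = 0})"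


section \<open>The derivation \<open>\<partial>\<close> and the cyclic derivative\<close>

text \<open>An element of \<open>M\<^sub>m(\<complex>) \<otimes> M\<^sub>n(\<complex>)\<close> is given by its coefficients: \<open>T a b c d\<close> is the coefficient of
  \<open>e\<^sub>a\<^sub>b \<otimes> e\<^sub>c\<^sub>d\<close>. The lemmas below characterize the operations on elementary tensors.\<close>

type_synonym tensor = "nat \<Rightarrow> nat \<Rightarrow> nat \<Rightarrow> nat \<Rightarrow> complex"

definition elem_tensor :: "complex mat \<Rightarrow> complex mat \<Rightarrow> tensor" where
  "elem_tensor x y a b c d = x $$ (a, b) * y $$ (c, d)"

definition tensor_flip :: "tensor \<Rightarrow> tensor" where
  "tensor_flip T a b c d = T c d a b"

definition tensor_mult :: "nat \<Rightarrow> tensor \<Rightarrow> complex mat" where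
  "tensor_mult n T = mat n n (\<lambda>(i, j). \<Sum>k<n. T i k k j)"

lemma tensor_flip_elem: "tensor_flip (elem_tensor x y) = elem_tensor y x"
  by (intro ext) (simp add: tensor_flip_def elem_tensor_def)

lemma tensor_mult_elem:
  assumes "x \<in> carrier_mat n n" "y \<in> carrier_mat n n"
  shows "tensor_mult n (elem_tensor x y) = x * y"
  using assms by (intro eq_matI)
    (auto simp: tensor_mult_def elem_tensor_def scalar_prod_def lessThan_atLeast0)

text \<open>The derivative in the complex variable \<open>\<epsilon>\<close> is taken entrywise.\<close>

definition fdq :: "'b::complex_unital_banach_algebra family \<Rightarrow>
    nat \<Rightarrow> nat \<Rightarrow> 'b mat \<Rightarrow> 'b mat \<Rightarrow> tensor" where  \<comment> \<open>\<open>(\<partial>f)\<^sub>m\<^sub>;\<^sub>n(\<beta>;\<beta>')\<close>\<close>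
  "fdq f m n \<beta> \<beta>' a b c d =
     deriv (\<lambda>\<epsilon>. f (m + n) (four_block_mat \<beta> (scal (\<epsilon> \<cdot>\<^sub>m mat_unit m n b c)) (0\<^sub>m n m) \<beta>')
                   $$ (a, m + d)) 0"

definition cyc_deriv ::
    "'b::complex_unital_banach_algebra family \<Rightarrow> 'b family" where
  "cyc_deriv f = family (\<lambda>n \<beta>. tensor_mult n (tensor_flip (fdq f n n \<beta> \<beta>)))"

definition Dstar :: "('b \<Rightarrow> complex) \<Rightarrow> 'b family \<Rightarrow> 'b family" where
  "Dstar \<theta> f = fam_mult f (zfam \<theta>)"

definition C_op ::
    "('b::complex_unital_banach_algebra \<Rightarrow> complex) \<Rightarrow> 'b family \<Rightarrow> 'b family" where
  "C_op \<theta> = Dstar \<theta> \<circ> cyc_deriv"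

definition ker_on :: "('b family \<Rightarrow> 'b family) \<Rightarrow> 'b family set \<Rightarrow> 'b family set" where
  "ker_on T V = {f \<in> V. T f = fam_zero}"

end

theory Submission
  imports Defs
begin

text \<open>
  For a word \<open>w = \<phi>\<^sub>1 \<dots> \<phi>\<^sub>k\<close> in \<open>B\<^sup>d\<close> let \<open>z(w) = z(\<phi>\<^sub>1) \<cdots> z(\<phi>\<^sub>k)\<close>. The words over a set \<open>S\<close> of functionals
  span the unital subalgebra generated by \<open>z(S)\<close> (\<open>subalgebra_hull_eq_span\<close>), so every linear claim
  about this subalgebra need only be checked on words. Evaluating \<open>z(w)\<close> at an upper triangular block
  matrix shows that \<open>D z(w)\<close> is the sum of \<open>\<phi>\<^sub>i(1) z(\<phi>\<^sub>i\<^sub>+\<^sub>1 \<dots> \<phi>\<^sub>k \<phi>\<^sub>1 \<dots> \<phi>\<^sub>i\<^sub>-\<^sub>1)\<close> over \<open>i\<close>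
  (\<open>cyc_deriv_zword\<close>). This vanishes if all \<open>\<phi>\<^sub>i(1)\<close> do, and it does not change when \<open>w\<close> is rotated
  cyclically; so \<open>D\<close> kills \<open>Z(1\<^sup>\<bottom>)\<close> and all commutators. As \<open>C\<^sub>\<theta> f = Df \<cdot> z(\<theta>)\<close>, the kernel of \<open>D\<close> is
  contained in that of \<open>C\<^sub>\<theta>\<close>, and it remains to show that the kernel of \<open>C\<^sub>\<theta>\<close> lies in
  \<open>Z(1\<^sup>\<bottom>) + [Z(B\<^sup>d), Z(B\<^sup>d)]\<close>.

  Since \<open>B\<^sup>d = \<complex>\<theta> \<oplus> 1\<^sup>\<bottom>\<close>, the algebra \<open>Z(B\<^sup>d)\<close> is spanned by the words over \<open>\<theta>\<close> and \<open>1\<^sup>\<bottom>\<close>. Let the degree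
  of such a word be the number \<open>k\<close> of its letters \<open>\<theta>\<close>. Then \<open>C\<^sub>\<theta> z(w)\<close> is the sum of \<open>k\<close> words, the
  rotations of \<open>w\<close> that end in \<open>\<theta>\<close>. They have degree \<open>k\<close> as well, and each of them equals \<open>z(w)\<close> modulo
  commutators (\<open>C_op_mod_commutators\<close>). Write \<open>f = f\<^sub>0 + \<dots> + f\<^sub>N\<close> with \<open>f\<^sub>k\<close> of degree \<open>k\<close>. The map
  \<open>b \<mapsto> b + (t - 1)\<theta>(b)1\<close> of \<open>B\<close> multiplies \<open>\<theta>\<close> by \<open>t\<close> and leaves the functionals in \<open>1\<^sup>\<bottom>\<close> unchanged, hence
  multiplies the values of \<open>C\<^sub>\<theta> f\<^sub>k\<close> by \<open>t\<^sup>k\<close>. If \<open>C\<^sub>\<theta> f = 0\<close>, comparison of the coefficients of a polynomial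
  in \<open>t\<close> gives \<open>C\<^sub>\<theta> f\<^sub>k = 0\<close> for each \<open>k\<close>, so \<open>k f\<^sub>k\<close> is in the span of the commutators, and so is
  \<open>f\<^sub>k\<close> for \<open>k \<ge> 1\<close>. Finally \<open>f\<^sub>0 \<in> Z(1\<^sup>\<bottom>)\<close>.
\<close>

section \<open>Families of matrix functions\<close>

text \<open>Extensional families of functions \<open>M\<^sub>n(B) \<rightarrow> M\<^sub>n(\<complex>)\<close>, with no condition on the
  functions.\<close>

definition Fam :: "'b::complex_unital_banach_algebra family set" where
  "Fam = (\<Pi>\<^sub>E n\<in>{1..}. carrier_mat n n \<rightarrow>\<^sub>E carrier_mat n n)"

lemma Fam_carrier [simp]:
  assumes "f \<in> Fam" "n \<ge> 1" "\<beta> \<in> carrier_mat n n"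
  shows "f n \<beta> \<in> carrier_mat n n"
proof -
  have "f n \<in> carrier_mat n n \<rightarrow>\<^sub>E carrier_mat n n"
    using assms unfolding Fam_def by (auto intro: PiE_mem)
  then show ?thesis using assms by (auto intro: PiE_mem)
qed

lemma Fam_dim [simp]:
  assumes "f \<in> Fam" "n \<ge> 1" "\<beta> \<in> carrier_mat n n"
  shows "dim_row (f n \<beta>) = n" "dim_col (f n \<beta>) = n"
  using Fam_carrier[OF assms] by auto

lemma family_in_Fam:
  assumes "\<And>n \<beta>. n \<ge> 1 \<Longrightarrow> \<beta> \<in> carrier_mat n n \<Longrightarrow> F n \<beta> \<in> carrier_mat n n"
  shows "family F \<in> Fam"
  using assms unfolding Fam_def by (auto intro!: PiE_I)

lemma Fam_eqI:
  assumes f: "f \<in> Fam" and g: "g \<in> Fam"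
    and eq: "\<And>n \<beta> i j. \<lbrakk>n \<ge> 1; \<beta> \<in> carrier_mat n n; i < n; j < n\<rbrakk> \<Longrightarrow>
      f n \<beta> $$ (i, j) = g n \<beta> $$ (i, j)"
  shows "f = g"
proof (rule PiE_ext[OF f[unfolded Fam_def] g[unfolded Fam_def]])
  fix n :: nat assume n: "n \<in> {1..}"
  have fn: "f n \<in> carrier_mat n n \<rightarrow>\<^sub>E carrier_mat n n"
    and gn: "g n \<in> carrier_mat n n \<rightarrow>\<^sub>E carrier_mat n n"
    using f g n unfolding Fam_def by (auto intro: PiE_mem)
  show "f n = g n"
  proof (rule PiE_ext[OF fn gn])
    fix \<beta> :: "'a mat" assume b: "\<beta> \<in> carrier_mat n n"
    show "f n \<beta> = g n \<beta>"
      using n b f g by (intro eq_matI) (auto intro: eq)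
  qed
qed

lemmas square_mult_carrier = mult_carrier_mat[of A n n B n for A n B]

lemma AM_Fam: "f \<in> AM \<Longrightarrow> f \<in> Fam"
  by (simp add: AM_def Fam_def)

lemma Fam_closed [simp]:
  "fam_zero \<in> Fam" "fam_one \<in> Fam"
  "f \<in> Fam \<Longrightarrow> g \<in> Fam \<Longrightarrow> fam_add f g \<in> Fam"
  "f \<in> Fam \<Longrightarrow> g \<in> Fam \<Longrightarrow> fam_diff f g \<in> Fam"
  "f \<in> Fam \<Longrightarrow> g \<in> Fam \<Longrightarrow> fam_mult f g \<in> Fam"
  "f \<in> Fam \<Longrightarrow> fam_smult c f \<in> Fam"
  "zfam \<phi> \<in> Fam"
  unfolding fam_zero_def fam_one_def fam_add_def fam_diff_def fam_mult_def fam_smult_def zfam_def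
  by (rule family_in_Fam, simp add: minus_carrier_mat square_mult_carrier)+

lemma fam_apply:
  assumes "n \<ge> 1" "\<beta> \<in> carrier_mat n n"
  shows "fam_zero n \<beta> = 0\<^sub>m n n" "fam_one n \<beta> = 1\<^sub>m n"
    "fam_add f g n \<beta> = f n \<beta> + g n \<beta>" "fam_diff f g n \<beta> = f n \<beta> - g n \<beta>"
    "fam_mult f g n \<beta> = f n \<beta> * g n \<beta>" "fam_smult c f n \<beta> = c \<cdot>\<^sub>m f n \<beta>"
    "zfam \<phi> n \<beta> = map_mat \<phi> \<beta>"
  using assms
  unfolding fam_zero_def fam_one_def fam_add_def fam_diff_def fam_mult_def fam_smult_def zfam_def
  by auto

lemma mult_mat_entry:
  assumes "A \<in> carrier_mat n m" "B \<in> carrier_mat m k" "i < n" "j < k"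
  shows "(A * B) $$ (i, j) = (\<Sum>l<m. A $$ (i, l) * B $$ (l, j))"
  using assms by (auto simp: scalar_prod_def lessThan_atLeast0)

lemma fam_entry:
  assumes "n \<ge> 1" "\<beta> \<in> carrier_mat n n" "i < n" "j < n"
  shows "fam_zero n \<beta> $$ (i, j) = 0" "fam_one n \<beta> $$ (i, j) = (if i = j then 1 else 0)"
    "f \<in> Fam \<Longrightarrow> g \<in> Fam \<Longrightarrow> fam_add f g n \<beta> $$ (i, j) = f n \<beta> $$ (i, j) + g n \<beta> $$ (i, j)"
    "f \<in> Fam \<Longrightarrow> g \<in> Fam \<Longrightarrow> fam_diff f g n \<beta> $$ (i, j) = f n \<beta> $$ (i, j) - g n \<beta> $$ (i, j)"
    "f \<in> Fam \<Longrightarrow> g \<in> Fam \<Longrightarrow>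
       fam_mult f g n \<beta> $$ (i, j) = (\<Sum>l<n. f n \<beta> $$ (i, l) * g n \<beta> $$ (l, j))"
    "f \<in> Fam \<Longrightarrow> fam_smult c f n \<beta> $$ (i, j) = c * f n \<beta> $$ (i, j)"
    "zfam \<phi> n \<beta> $$ (i, j) = \<phi> (\<beta> $$ (i, j))"
  using assms by (auto simp: fam_apply mult_mat_entry[where n=n and m=n and k=n] simp del: index_mult_mat(1))

lemma fam_mult_one:
  assumes "f \<in> Fam"
  shows "fam_mult f fam_one = f" "fam_mult fam_one f = f"
  by (rule Fam_eqI; use assms in \<open>simp add: fam_apply left_mult_one_mat[where nc = n for n]
    right_mult_one_mat[where nr = n for n]\<close>)+

lemma fam_mult_assoc:
  assumes "f \<in> Fam" "g \<in> Fam" "h \<in> Fam"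
  shows "fam_mult (fam_mult f g) h = fam_mult f (fam_mult g h)"
  by (rule Fam_eqI; use assms in \<open>simp add: fam_apply
     assoc_mult_mat[OF Fam_carrier Fam_carrier Fam_carrier]\<close>)

lemma fam_mult_zero:
  assumes "f \<in> Fam"
  shows "fam_mult fam_zero f = fam_zero" "fam_mult f fam_zero = fam_zero"
  by (rule Fam_eqI; use assms in \<open>simp add: fam_entry\<close>)+

lemma fam_mult_distrib:
  assumes "f \<in> Fam" "g \<in> Fam" "h \<in> Fam"
  shows "fam_mult (fam_add f g) h = fam_add (fam_mult f h) (fam_mult g h)"
    and "fam_mult h (fam_add f g) = fam_add (fam_mult h f) (fam_mult h g)"
  by (rule Fam_eqI; use assms in \<open>simp add: fam_entry algebra_simps sum.distrib\<close>)+

lemma fam_mult_smult: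
  assumes "f \<in> Fam" "g \<in> Fam"
  shows "fam_mult (fam_smult c f) g = fam_smult c (fam_mult f g)"
    and "fam_mult f (fam_smult c g) = fam_smult c (fam_mult f g)"
  by (rule Fam_eqI; use assms in \<open>simp add: fam_entry algebra_simps sum_distrib_left\<close>)+

lemma fam_diff_alt:
  assumes "f \<in> Fam" "g \<in> Fam"
  shows "fam_diff f g = fam_add f (fam_smult (-1) g)"
  by (rule Fam_eqI; use assms in \<open>simp add: fam_entry\<close>)


section \<open>The algebra of analytic noncommutative functions\<close>

lemma entry_norm_nonneg: "entry_norm A \<ge> 0"
  by (simp add: entry_norm_def sum_nonneg)

lemma entry_norm_add:
  assumes "A \<in> carrier_mat n m" "B \<in> carrier_mat n m"
  shows "entry_norm (A + B) \<le> entry_norm A + entry_norm B"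
  using assms unfolding entry_norm_def
  by (auto simp: sum.distrib[symmetric] intro!: sum_mono norm_triangle_ineq)

lemma entry_norm_mult:
  assumes A: "A \<in> carrier_mat n n" and B: "(B :: complex mat) \<in> carrier_mat n n"
  shows "entry_norm (A * B) \<le> entry_norm A * entry_norm B"
proof -
  have row: "(\<Sum>j<n. cmod (B $$ (k, j))) \<le> entry_norm B" if "k < n" for k
    using B that unfolding entry_norm_def
    by (auto intro!: member_le_sum[of k "{..<n}" "\<lambda>k. \<Sum>j<n. cmod (B $$ (k, j))"] sum_nonneg)
  have "entry_norm (A * B) = (\<Sum>i<n. \<Sum>j<n. cmod (\<Sum>k<n. A $$ (i, k) * B $$ (k, j)))"
    using A B by (simp add: entry_norm_def mult_mat_entry[OF A B] del: index_mult_mat(1))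
  also have "\<dots> \<le> (\<Sum>i<n. \<Sum>j<n. \<Sum>k<n. cmod (A $$ (i, k)) * cmod (B $$ (k, j)))"
    by (intro sum_mono order_trans[OF norm_sum]) (simp add: norm_mult)
  also have "\<dots> = (\<Sum>i<n. \<Sum>k<n. cmod (A $$ (i, k)) * (\<Sum>j<n. cmod (B $$ (k, j))))"
    by (subst sum.swap) (simp add: sum_distrib_left)
  also have "\<dots> \<le> (\<Sum>i<n. \<Sum>k<n. cmod (A $$ (i, k)) * entry_norm B)"
    by (intro sum_mono mult_left_mono row) auto
  also have "\<dots> = entry_norm A * entry_norm B"
    using A by (simp add: entry_norm_def[of A] sum_distrib_right)
  finally show ?thesis .
qed

lemma entry_norm_zero [simp]: "entry_norm (0\<^sub>m n m :: 'a::real_normed_vector mat) = 0"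
  by (simp add: entry_norm_def)

text \<open>Complex Frechet differentiability at one point, with a nonnegative bound for the derivative
  singled out.\<close>

definition frechet_at ::
    "nat \<Rightarrow> ('b::complex_unital_banach_algebra mat \<Rightarrow> complex mat) \<Rightarrow> 'b mat \<Rightarrow>
     ('b mat \<Rightarrow> complex mat) \<Rightarrow> real \<Rightarrow> bool" where
  "frechet_at n F \<beta> L C \<longleftrightarrow>
     L \<in> carrier_mat n n \<rightarrow> carrier_mat n n \<and>
     (\<forall>H\<in>carrier_mat n n. \<forall>K\<in>carrier_mat n n. L (H + K) = L H + L K) \<and>
     (\<forall>c. \<forall>H\<in>carrier_mat n n. L (map_mat ((*\<^sub>C) c) H) = c \<cdot>\<^sub>m L H) \<and>
     C \<ge> 0 \<and> (\<forall>H\<in>carrier_mat n n. entry_norm (L H) \<le> C * entry_norm H) \<and>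
     (\<forall>e>0. \<exists>d>0. \<forall>H\<in>carrier_mat n n. entry_norm H < d \<longrightarrow>
        entry_norm (F (\<beta> + H) - F \<beta> - L H) \<le> e * entry_norm H)"

lemma analytic_mat_frechet_at:
  "analytic_mat n F \<longleftrightarrow> (\<forall>\<beta>\<in>carrier_mat n n. \<exists>L C. frechet_at n F \<beta> L C)"
proof -
  have *: "(\<exists>C. \<forall>H\<in>carrier_mat n n. entry_norm (L H) \<le> C * entry_norm H) \<longleftrightarrow>
    (\<exists>C\<ge>0. \<forall>H\<in>carrier_mat n n. entry_norm (L H) \<le> C * entry_norm H)"
    for L :: "'a mat \<Rightarrow> complex mat"
  proof
    assume "\<exists>C. \<forall>H\<in>carrier_mat n n. entry_norm (L H) \<le> C * entry_norm H"
    then obtain C where C: "\<And>H. H \<in> carrier_mat n n \<Longrightarrow> entry_norm (L H) \<le> C * entry_norm H" by blast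
    have "entry_norm (L H) \<le> \<bar>C\<bar> * entry_norm H" if "H \<in> carrier_mat n n" for H
      using C[OF that] mult_right_mono[OF abs_ge_self[of C] entry_norm_nonneg[of H]] by linarith
    then show "\<exists>C\<ge>0. \<forall>H\<in>carrier_mat n n. entry_norm (L H) \<le> C * entry_norm H"
      by (intro exI[of _ "\<bar>C\<bar>"]) auto
  qed blast
  have pull: "((P \<and> Q \<and> R \<and> (\<exists>C\<ge>0. X C)) \<and> E) \<longleftrightarrow> (\<exists>C. P \<and> Q \<and> R \<and> C \<ge> 0 \<and> X C \<and> E)"
    for P Q R E and X :: "real \<Rightarrow> bool"
    by blast
  show ?thesis
    unfolding analytic_mat_def bounded_clinear_mat_def frechet_at_def * pull ..
qed

lemma frechet_at_add:
  assumes F: "F \<in> carrier_mat n n \<rightarrow> carrier_mat n n" and G: "G \<in> carrier_mat n n \<rightarrow> carrier_mat n n"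
    and b: "\<beta> \<in> carrier_mat n n"
    and f: "frechet_at n F \<beta> L C" and g: "frechet_at n G \<beta> M C'"
  shows "frechet_at n (\<lambda>\<beta>. F \<beta> + G \<beta>) \<beta> (\<lambda>H. L H + M H) (C + C')"
proof -
  have L: "L H \<in> carrier_mat n n" "M H \<in> carrier_mat n n" if "H \<in> carrier_mat n n" for H
    using f g that by (auto simp: frechet_at_def)
  have lin: "L (H + K) + M (H + K) = L H + M H + (L K + M K)"
    if "H \<in> carrier_mat n n" "K \<in> carrier_mat n n" for H K
    using f g that L[OF that(1)] L[OF that(2)] by (intro eq_matI) (auto simp: frechet_at_def)
  have hom: "L (map_mat ((*\<^sub>C) c) H) + M (map_mat ((*\<^sub>C) c) H) = c \<cdot>\<^sub>m (L H + M H)"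
    if "H \<in> carrier_mat n n" for H c
    using f g that L[OF that] by (intro eq_matI) (auto simp: frechet_at_def algebra_simps)
  have bd: "entry_norm (L H + M H) \<le> (C + C') * entry_norm H" if "H \<in> carrier_mat n n" for H
  proof -
    have "entry_norm (L H) \<le> C * entry_norm H" "entry_norm (M H) \<le> C' * entry_norm H"
      using f g that by (auto simp: frechet_at_def)
    then show ?thesis using entry_norm_add[OF L[OF that]] by (simp add: algebra_simps)
  qed
  have "\<exists>d>0. \<forall>H\<in>carrier_mat n n. entry_norm H < d \<longrightarrow>
        entry_norm (F (\<beta> + H) + G (\<beta> + H) - (F \<beta> + G \<beta>) - (L H + M H)) \<le> e * entry_norm H"
    if e: "e > 0" for e
  proof -
    obtain d1 where d1: "d1 > 0" "\<And>H. H \<in> carrier_mat n n \<Longrightarrow> entry_norm H < d1 \<Longrightarrow>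
        entry_norm (F (\<beta> + H) - F \<beta> - L H) \<le> e / 2 * entry_norm H"
      using f e unfolding frechet_at_def by (meson half_gt_zero)
    obtain d2 where d2: "d2 > 0" "\<And>H. H \<in> carrier_mat n n \<Longrightarrow> entry_norm H < d2 \<Longrightarrow>
        entry_norm (G (\<beta> + H) - G \<beta> - M H) \<le> e / 2 * entry_norm H"
      using g e unfolding frechet_at_def by (meson half_gt_zero)
    have "entry_norm (F (\<beta> + H) + G (\<beta> + H) - (F \<beta> + G \<beta>) - (L H + M H)) \<le> e * entry_norm H"
      if H: "H \<in> carrier_mat n n" "entry_norm H < min d1 d2" for H
    proof -
      have c: "F (\<beta> + H) \<in> carrier_mat n n" "G (\<beta> + H) \<in> carrier_mat n n"
        "F \<beta> \<in> carrier_mat n n" "G \<beta> \<in> carrier_mat n n"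
        using F G b H by auto
      have "F (\<beta> + H) + G (\<beta> + H) - (F \<beta> + G \<beta>) - (L H + M H) =
          (F (\<beta> + H) - F \<beta> - L H) + (G (\<beta> + H) - G \<beta> - M H)"
        using c L[OF H(1)] by (intro eq_matI) auto
      then have "entry_norm (F (\<beta> + H) + G (\<beta> + H) - (F \<beta> + G \<beta>) - (L H + M H)) \<le>
          entry_norm (F (\<beta> + H) - F \<beta> - L H) + entry_norm (G (\<beta> + H) - G \<beta> - M H)"
        using c L[OF H(1)] entry_norm_add[of "F (\<beta> + H) - F \<beta> - L H" n n]
        by (simp add: minus_carrier_mat)
      also have "\<dots> \<le> e / 2 * entry_norm H + e / 2 * entry_norm H"
        using d1(2)[OF H(1)] d2(2)[OF H(1)] H(2) by simp
      finally show ?thesis by simp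
    qed
    then show ?thesis using d1(1) d2(1) by (intro exI[of _ "min d1 d2"]) auto
  qed
  then show ?thesis
    using f g L lin hom bd unfolding frechet_at_def by auto
qed

lemma product_increment:
  fixes A :: "complex mat"
  assumes "A \<in> carrier_mat n n" "A' \<in> carrier_mat n n" "B \<in> carrier_mat n n" "B' \<in> carrier_mat n n"
    "L \<in> carrier_mat n n" "M \<in> carrier_mat n n"
  shows "A' * B' - A * B - (L * B + A * M) =
    (A' - A - L) * B + A * (B' - B - M) + (L + (A' - A - L)) * (M + (B' - B - M))"
  using assms
  by (intro eq_matI) (simp_all add: mult_mat_entry[where n=n and m=n and k=n] minus_carrier_mat
    algebra_simps sum.distrib sum_subtractf del: index_mult_mat(1))

text \<open>The product rule. In the increment of the product, all terms but the linear one are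
  bounded by multiples of the two remainders or quadratic in the increment of the argument.\<close>

lemma frechet_at_mult:
  assumes F: "F \<in> carrier_mat n n \<rightarrow> carrier_mat n n" and G: "G \<in> carrier_mat n n \<rightarrow> carrier_mat n n"
    and b: "\<beta> \<in> carrier_mat n n"
    and f: "frechet_at n F \<beta> L C" and g: "frechet_at n G \<beta> M C'"
  shows "frechet_at n (\<lambda>\<beta>. F \<beta> * G \<beta>) \<beta> (\<lambda>H. L H * G \<beta> + F \<beta> * M H)
    (C * entry_norm (G \<beta>) + entry_norm (F \<beta>) * C')"
proof -
  have L: "L H \<in> carrier_mat n n" "M H \<in> carrier_mat n n" if "H \<in> carrier_mat n n" for H
    using f g that by (auto simp: frechet_at_def)
  have fg: "F \<beta> \<in> carrier_mat n n" "G \<beta> \<in> carrier_mat n n" using F G b by auto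
  have C: "C \<ge> 0" "C' \<ge> 0" using f g by (auto simp: frechet_at_def)
  have bL: "entry_norm (L H) \<le> C * entry_norm H" "entry_norm (M H) \<le> C' * entry_norm H"
    if "H \<in> carrier_mat n n" for H
    using f g that by (auto simp: frechet_at_def)
  have lin: "L (H + K) * G \<beta> + F \<beta> * M (H + K) = L H * G \<beta> + F \<beta> * M H + (L K * G \<beta> + F \<beta> * M K)"
    if "H \<in> carrier_mat n n" "K \<in> carrier_mat n n" for H K
  proof -
    have e: "L (H + K) = L H + L K" "M (H + K) = M H + M K"
      using f g that by (auto simp: frechet_at_def)
    show ?thesis
      unfolding e using L[OF that(1)] L[OF that(2)] fg
      by (intro eq_matI) (auto simp: mult_mat_entry[where n=n and m=n and k=n]
        algebra_simps sum.distrib simp del: index_mult_mat(1))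
  qed
  have hom: "L (map_mat ((*\<^sub>C) c) H) * G \<beta> + F \<beta> * M (map_mat ((*\<^sub>C) c) H) = c \<cdot>\<^sub>m (L H * G \<beta> + F \<beta> * M H)"
    if "H \<in> carrier_mat n n" for H c
  proof -
    have e: "L (map_mat ((*\<^sub>C) c) H) = c \<cdot>\<^sub>m L H" "M (map_mat ((*\<^sub>C) c) H) = c \<cdot>\<^sub>m M H"
      using f g that by (auto simp: frechet_at_def)
    show ?thesis
      unfolding e using L[OF that(1)] fg
      by (intro eq_matI) (auto simp: mult_mat_entry[where n=n and m=n and k=n]
        algebra_simps sum_distrib_left simp del: index_mult_mat(1))
  qed
  have bd: "entry_norm (L H * G \<beta> + F \<beta> * M H) \<le>
      (C * entry_norm (G \<beta>) + entry_norm (F \<beta>) * C') * entry_norm H" if "H \<in> carrier_mat n n" for H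
  proof -
    have "entry_norm (L H * G \<beta> + F \<beta> * M H) \<le>
        entry_norm (L H) * entry_norm (G \<beta>) + entry_norm (F \<beta>) * entry_norm (M H)"
      using L[OF that] fg entry_norm_add[of "L H * G \<beta>" n n "F \<beta> * M H"]
        entry_norm_mult[of "L H" n "G \<beta>"] entry_norm_mult[of "F \<beta>" n "M H"] by auto
    also have "\<dots> \<le> C * entry_norm H * entry_norm (G \<beta>) + entry_norm (F \<beta>) * (C' * entry_norm H)"
      by (intro add_mono mult_right_mono mult_left_mono bL that entry_norm_nonneg)
    finally show ?thesis by (simp add: algebra_simps)
  qed
  have small: "\<exists>d>0. \<forall>H\<in>carrier_mat n n. entry_norm H < d \<longrightarrow>
        entry_norm (F (\<beta> + H) * G (\<beta> + H) - F \<beta> * G \<beta> - (L H * G \<beta> + F \<beta> * M H)) \<le> e * entry_norm H"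
    if e: "e > 0" for e
  proof -
    define p where "p = entry_norm (F \<beta>) + 1"
    define q where "q = entry_norm (G \<beta>) + 1"
    define r where "r = (C + 1) * (C' + 1)"
    have pqr: "p > 0" "q > 0" "r > 0"
      using entry_norm_nonneg[of "F \<beta>"] entry_norm_nonneg[of "G \<beta>"] C by (auto simp: p_def q_def r_def)
    have ex: "\<exists>d>0. \<forall>H\<in>carrier_mat n n. entry_norm H < d \<longrightarrow>
        entry_norm (F (\<beta> + H) - F \<beta> - L H) \<le> x * entry_norm H \<and>
        entry_norm (G (\<beta> + H) - G \<beta> - M H) \<le> x * entry_norm H" if "x > 0" for x
    proof -
      obtain d1 where "d1 > 0" "\<And>H. H \<in> carrier_mat n n \<Longrightarrow> entry_norm H < d1 \<Longrightarrow>
          entry_norm (F (\<beta> + H) - F \<beta> - L H) \<le> x * entry_norm H"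
        using f \<open>x > 0\<close> unfolding frechet_at_def by meson
      moreover obtain d2 where "d2 > 0" "\<And>H. H \<in> carrier_mat n n \<Longrightarrow> entry_norm H < d2 \<Longrightarrow>
          entry_norm (G (\<beta> + H) - G \<beta> - M H) \<le> x * entry_norm H"
        using g \<open>x > 0\<close> unfolding frechet_at_def by meson
      ultimately show ?thesis by (intro exI[of _ "min d1 d2"]) auto
    qed
    \<comment> \<open>One tolerance \<open>x\<close> serves both factors and bounds the increment. The three error terms are then
      at most \<open>q\<close>, \<open>p\<close> and \<open>r\<close> times \<open>x\<close> times the norm of the increment.\<close>
    define x where "x = min 1 (e / (p + q + r))"
    have x: "x > 0" "x \<le> 1" "x \<le> e / (p + q + r)"
      using pqr e by (auto simp: x_def)
    then have x_e: "x * (p + q + r) \<le> e"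
      using pqr by (simp add: pos_le_divide_eq)
    obtain d where d: "d > 0" "\<And>H. H \<in> carrier_mat n n \<Longrightarrow> entry_norm H < d \<Longrightarrow>
        entry_norm (F (\<beta> + H) - F \<beta> - L H) \<le> x * entry_norm H \<and>
        entry_norm (G (\<beta> + H) - G \<beta> - M H) \<le> x * entry_norm H"
      using ex[OF x(1)] by blast
    have "entry_norm (F (\<beta> + H) * G (\<beta> + H) - F \<beta> * G \<beta> - (L H * G \<beta> + F \<beta> * M H)) \<le> e * entry_norm H"
      if H: "H \<in> carrier_mat n n" "entry_norm H < min d x" for H
    proof -
      define h where "h = entry_norm H"
      have h: "h \<ge> 0" "h \<le> x" using entry_norm_nonneg[of H] H(2) by (auto simp: h_def)
      define R where "R = F (\<beta> + H) - F \<beta> - L H"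
      define S where "S = G (\<beta> + H) - G \<beta> - M H"
      have bH: "\<beta> + H \<in> carrier_mat n n" using b H by auto
      have c: "F (\<beta> + H) \<in> carrier_mat n n" "G (\<beta> + H) \<in> carrier_mat n n"
        using funcset_mem[OF F bH] funcset_mem[OF G bH] by auto
      have RS: "R \<in> carrier_mat n n" "S \<in> carrier_mat n n" "entry_norm R \<le> x * h" "entry_norm S \<le> x * h"
        using c L[OF H(1)] fg d(2)[OF H(1)] H(2) by (auto simp: R_def S_def h_def)
      have dF: "entry_norm (L H + R) \<le> (C + 1) * h" "entry_norm (M H + S) \<le> (C' + 1) * h"
      proof -
        have "x * h \<le> h" using x h by (simp add: mult_left_le_one_le)
        then show "entry_norm (L H + R) \<le> (C + 1) * h"
          using entry_norm_add[OF L(1)[OF H(1)] RS(1)] bL(1)[OF H(1)] RS(3)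
          by (simp add: algebra_simps h_def)
        show "entry_norm (M H + S) \<le> (C' + 1) * h"
          using entry_norm_add[OF L(2)[OF H(1)] RS(2)] bL(2)[OF H(1)] RS(4) \<open>x * h \<le> h\<close>
          by (simp add: algebra_simps h_def)
      qed
      have "F (\<beta> + H) * G (\<beta> + H) - F \<beta> * G \<beta> - (L H * G \<beta> + F \<beta> * M H) =
          R * G \<beta> + F \<beta> * S + (L H + R) * (M H + S)"
        unfolding R_def S_def by (rule product_increment) (use c fg L[OF H(1)] in auto)
      also have "entry_norm \<dots> \<le>
          entry_norm R * entry_norm (G \<beta>) + entry_norm (F \<beta>) * entry_norm S +
          entry_norm (L H + R) * entry_norm (M H + S)"
        using L[OF H(1)] RS(1,2) fg
          entry_norm_add[of "R * G \<beta> + F \<beta> * S" n n "(L H + R) * (M H + S)"]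
          entry_norm_add[of "R * G \<beta>" n n "F \<beta> * S"]
          entry_norm_mult[of R n "G \<beta>"] entry_norm_mult[of "F \<beta>" n S]
          entry_norm_mult[of "L H + R" n "M H + S"]
        by (simp add: square_mult_carrier)
      also have "\<dots> \<le> x * h * q + p * (x * h) + (C + 1) * h * ((C' + 1) * h)"
        by (intro add_mono mult_mono RS dF)
          (use x h C pqr in \<open>auto simp: p_def q_def entry_norm_nonneg\<close>)
      also have "\<dots> = x * h * q + p * (x * h) + r * h * h" by (simp add: r_def algebra_simps)
      also have "\<dots> \<le> x * h * q + p * (x * h) + r * h * x"
        using h pqr by (intro add_left_mono mult_left_mono) auto
      also have "\<dots> = x * (p + q + r) * h" by (simp add: algebra_simps)
      also have "\<dots> \<le> e * h" using x_e h by (intro mult_right_mono)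
      finally show ?thesis by (simp add: h_def)
    qed
    then show ?thesis using d(1) x(1) by (intro exI[of _ "min d x"]) auto
  qed
  then show ?thesis
    using C L fg lin hom bd unfolding frechet_at_def by (auto simp: entry_norm_nonneg)
qed

lemma frechet_at_const:
  assumes "A \<in> carrier_mat n n"
  shows "frechet_at n (\<lambda>_. A) \<beta> (\<lambda>_. 0\<^sub>m n n) 0"
proof -
  have "A - A - 0\<^sub>m n n = 0\<^sub>m n n" using assms by (intro eq_matI) auto
  then show ?thesis unfolding frechet_at_def
    by (auto simp: entry_norm_nonneg intro: exI[of _ 1])
qed

lemma top_dualD:
  assumes "\<phi> \<in> top_dual"
  shows "\<phi> (x + y) = \<phi> x + \<phi> y" "\<phi> (x - y) = \<phi> x - \<phi> y" "\<phi> 0 = 0" "\<phi> (c *\<^sub>C x) = c * \<phi> x"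
    "\<phi> (sum g I) = (\<Sum>i\<in>I. \<phi> (g i))" "\<exists>K\<ge>0. \<forall>x. cmod (\<phi> x) \<le> K * norm x"
proof -
  have b: "bounded_linear \<phi>" using assms by (simp add: top_dual_def)
  then interpret bounded_linear \<phi> .
  show "\<phi> (x + y) = \<phi> x + \<phi> y" "\<phi> (x - y) = \<phi> x - \<phi> y" "\<phi> 0 = 0" "\<phi> (sum g I) = (\<Sum>i\<in>I. \<phi> (g i))"
    by (simp_all add: add diff zero sum)
  show "\<phi> (c *\<^sub>C x) = c * \<phi> x" using assms by (simp add: top_dual_def)
  show "\<exists>K\<ge>0. \<forall>x. cmod (\<phi> x) \<le> K * norm x" using nonneg_bounded by (simp add: mult.commute)
qed

lemma frechet_at_functional:
  assumes "\<phi> \<in> top_dual" "\<beta> \<in> carrier_mat n n"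
  shows "\<exists>C. frechet_at n (map_mat \<phi>) \<beta> (map_mat \<phi>) C"
proof -
  obtain K where K: "K \<ge> 0" "\<And>x. cmod (\<phi> x) \<le> K * norm x" using top_dualD(6)[OF assms(1)] by blast
  have "map_mat \<phi> (\<beta> + H) - map_mat \<phi> \<beta> - map_mat \<phi> H = 0\<^sub>m n n" if "H \<in> carrier_mat n n" for H
    using assms that by (intro eq_matI) (auto simp: top_dualD)
  moreover have "entry_norm (map_mat \<phi> H) \<le> K * entry_norm H" for H
    by (auto simp: entry_norm_def sum_distrib_left intro!: sum_mono K)
  moreover have "map_mat \<phi> (H + K) = map_mat \<phi> H + map_mat \<phi> K"
    if "H \<in> carrier_mat n n" "K \<in> carrier_mat n n" for H K
    using that assms(1) by (intro eq_matI) (auto simp: top_dualD)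
  moreover have "map_mat \<phi> (map_mat ((*\<^sub>C) c) H) = c \<cdot>\<^sub>m map_mat \<phi> H" for c H
    using assms(1) by (intro eq_matI) (auto simp: top_dualD)
  ultimately have "frechet_at n (map_mat \<phi>) \<beta> (map_mat \<phi>) K"
    using K(1) unfolding frechet_at_def by (auto simp: entry_norm_nonneg intro: exI[of _ 1])
  then show ?thesis ..
qed


lemma frechet_at_cong:
  assumes "frechet_at n F \<beta> L C" "\<beta> \<in> carrier_mat n n"
    "\<And>\<beta>. \<beta> \<in> carrier_mat n n \<Longrightarrow> F \<beta> = G \<beta>"
  shows "frechet_at n G \<beta> L C"
proof -
  have "G (\<beta> + H) - G \<beta> - L H = F (\<beta> + H) - F \<beta> - L H" if "H \<in> carrier_mat n n" for H
    using assms that by auto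
  then show ?thesis using assms(1) unfolding frechet_at_def by simp
qed

lemma scal_carrier [simp]: "s \<in> carrier_mat n m \<Longrightarrow> scal s \<in> carrier_mat n m"
  by (simp add: scal_def)

lemma dsum_carrier [simp]:
  "A \<in> carrier_mat m m \<Longrightarrow> B \<in> carrier_mat n n \<Longrightarrow> A \<oplus>\<^sub>m B \<in> carrier_mat (m + n) (m + n)"
  by (simp add: dsum_def)

lemma AM_I:
  assumes "f \<in> Fam"
    and "\<And>n \<beta>. n \<ge> 1 \<Longrightarrow> \<beta> \<in> carrier_mat n n \<Longrightarrow> \<exists>L C. frechet_at n (f n) \<beta> L C"
    and "\<And>m n \<beta> \<beta>'. \<lbrakk>m \<ge> 1; n \<ge> 1; \<beta> \<in> carrier_mat m m; \<beta>' \<in> carrier_mat n n\<rbrakk> \<Longrightarrow>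
      f (m + n) (\<beta> \<oplus>\<^sub>m \<beta>') = f m \<beta> \<oplus>\<^sub>m f n \<beta>'"
    and "\<And>n s t \<beta>. \<lbrakk>n \<ge> 1; s \<in> carrier_mat n n; t \<in> carrier_mat n n; s * t = 1\<^sub>m n; t * s = 1\<^sub>m n;
      \<beta> \<in> carrier_mat n n\<rbrakk> \<Longrightarrow> f n (scal s * \<beta> * scal t) = s * f n \<beta> * t"
  shows "f \<in> AM"
  unfolding AM_def analytic_mat_frechet_at
  by (intro CollectI conjI allI impI ballI)
    ((elim conjE)?, (rule assms assms(1)[unfolded Fam_def]; assumption))+

lemma AM_D:
  assumes "f \<in> AM"
  shows "n \<ge> 1 \<Longrightarrow> \<beta> \<in> carrier_mat n n \<Longrightarrow> \<exists>L C. frechet_at n (f n) \<beta> L C"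
    and "\<lbrakk>m \<ge> 1; n \<ge> 1; \<beta> \<in> carrier_mat m m; \<beta>' \<in> carrier_mat n n\<rbrakk> \<Longrightarrow>
      f (m + n) (\<beta> \<oplus>\<^sub>m \<beta>') = f m \<beta> \<oplus>\<^sub>m f n \<beta>'"
    and "\<lbrakk>n \<ge> 1; s \<in> carrier_mat n n; t \<in> carrier_mat n n; s * t = 1\<^sub>m n; t * s = 1\<^sub>m n;
      \<beta> \<in> carrier_mat n n\<rbrakk> \<Longrightarrow> f n (scal s * \<beta> * scal t) = s * f n \<beta> * t"
  using assms unfolding AM_def analytic_mat_frechet_at by blast+

lemma Fam_funcset: "f \<in> Fam \<Longrightarrow> n \<ge> 1 \<Longrightarrow> f n \<in> carrier_mat n n \<rightarrow> carrier_mat n n"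
  by auto

lemma AM_const: "fam_smult c fam_one \<in> AM"
proof (rule AM_I)
  fix n :: nat and \<beta> :: "'a mat" assume n: "n \<ge> 1" "\<beta> \<in> carrier_mat n n"
  have "frechet_at n (\<lambda>\<beta>::'a mat. c \<cdot>\<^sub>m 1\<^sub>m n) \<beta> (\<lambda>_. 0\<^sub>m n n) 0" by (rule frechet_at_const) simp
  then have "frechet_at n (fam_smult c fam_one n) \<beta> (\<lambda>_. 0\<^sub>m n n) 0"
    by (rule frechet_at_cong) (use n in \<open>auto simp: fam_apply\<close>)
  then show "\<exists>L C. frechet_at n (fam_smult c fam_one n) \<beta> L C" by blast
next
  fix m n :: nat and \<beta> \<beta>' :: "'a mat"
  assume *: "m \<ge> 1" "n \<ge> 1" "\<beta> \<in> carrier_mat m m" "\<beta>' \<in> carrier_mat n n"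
  show "fam_smult c fam_one (m + n) (\<beta> \<oplus>\<^sub>m \<beta>') = fam_smult c fam_one m \<beta> \<oplus>\<^sub>m fam_smult c fam_one n \<beta>'"
    using * by (intro eq_matI) (auto simp: fam_apply dsum_def[of "c \<cdot>\<^sub>m 1\<^sub>m m"])
next
  fix n and s t :: "complex mat" and \<beta> :: "'a mat"
  assume *: "n \<ge> 1" "s \<in> carrier_mat n n" "t \<in> carrier_mat n n" "s * t = 1\<^sub>m n" "\<beta> \<in> carrier_mat n n"
  have "scal s * \<beta> * scal t \<in> carrier_mat n n" using * by (intro square_mult_carrier) auto
  moreover have "s * (c \<cdot>\<^sub>m 1\<^sub>m n) * t = c \<cdot>\<^sub>m 1\<^sub>m n"
    using * by (simp add: mult_smult_distrib[of s n n _ n] mult_smult_assoc_mat[of _ n n])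
  ultimately show "fam_smult c fam_one n (scal s * \<beta> * scal t) = s * fam_smult c fam_one n \<beta> * t"
    using * by (simp add: fam_apply)
qed simp

lemma AM_add:
  assumes "f \<in> AM" "g \<in> AM"
  shows "fam_add f g \<in> AM"
proof (rule AM_I)
  have fg: "f \<in> Fam" "g \<in> Fam" using assms AM_Fam by auto
  then show "fam_add f g \<in> Fam" by simp
  {
    fix n :: nat and \<beta> :: "'a mat" assume n: "n \<ge> 1" "\<beta> \<in> carrier_mat n n"
    obtain L C M C' where "frechet_at n (f n) \<beta> L C" "frechet_at n (g n) \<beta> M C'"
      using AM_D(1)[OF assms(1) n] AM_D(1)[OF assms(2) n] by blast
    note frechet_at_add[OF Fam_funcset[OF fg(1) n(1)] Fam_funcset[OF fg(2) n(1)] n(2) this]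
    then have "frechet_at n (fam_add f g n) \<beta> (\<lambda>H. L H + M H) (C + C')"
      by (rule frechet_at_cong) (use n in \<open>auto simp: fam_apply\<close>)
    then show "\<exists>L C. frechet_at n (fam_add f g n) \<beta> L C" by blast
  next
    fix m n :: nat and \<beta> \<beta>' :: "'a mat"
    assume *: "m \<ge> 1" "n \<ge> 1" "\<beta> \<in> carrier_mat m m" "\<beta>' \<in> carrier_mat n n"
    have "(f m \<beta> \<oplus>\<^sub>m f n \<beta>') + (g m \<beta> \<oplus>\<^sub>m g n \<beta>') = (f m \<beta> + g m \<beta>) \<oplus>\<^sub>m (f n \<beta>' + g n \<beta>')"
      using * fg unfolding dsum_def
      by (subst add_four_block_mat[of _ m m _ n _ n]) auto
    then show "fam_add f g (m + n) (\<beta> \<oplus>\<^sub>m \<beta>') = fam_add f g m \<beta> \<oplus>\<^sub>m fam_add f g n \<beta>'"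
      using * by (simp add: fam_apply AM_D(2)[OF assms(1)] AM_D(2)[OF assms(2)])
  next
    fix n and s t :: "complex mat" and \<beta> :: "'a mat"
    assume *: "n \<ge> 1" "s \<in> carrier_mat n n" "t \<in> carrier_mat n n" "s * t = 1\<^sub>m n" "t * s = 1\<^sub>m n"
      "\<beta> \<in> carrier_mat n n"
    have "scal s * \<beta> * scal t \<in> carrier_mat n n" using * by (intro square_mult_carrier) auto
    moreover have "s * f n \<beta> * t + s * g n \<beta> * t = s * (f n \<beta> + g n \<beta>) * t"
      using * fg by (simp add: mult_add_distrib_mat[of s n n _ n] add_mult_distrib_mat[of _ n n _ _ n]
         square_mult_carrier)
    ultimately show "fam_add f g n (scal s * \<beta> * scal t) = s * fam_add f g n \<beta> * t"
      using * by (simp add: fam_apply AM_D(3)[OF assms(1)] AM_D(3)[OF assms(2)])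
  }
qed

lemma AM_mult:
  assumes "f \<in> AM" "g \<in> AM"
  shows "fam_mult f g \<in> AM"
proof (rule AM_I)
  have fg: "f \<in> Fam" "g \<in> Fam" using assms AM_Fam by auto
  then show "fam_mult f g \<in> Fam" by simp
  {
    fix n :: nat and \<beta> :: "'a mat" assume n: "n \<ge> 1" "\<beta> \<in> carrier_mat n n"
    obtain L C M C' where "frechet_at n (f n) \<beta> L C" "frechet_at n (g n) \<beta> M C'"
      using AM_D(1)[OF assms(1) n] AM_D(1)[OF assms(2) n] by blast
    note frechet_at_mult[OF Fam_funcset[OF fg(1) n(1)] Fam_funcset[OF fg(2) n(1)] n(2) this]
    then have "frechet_at n (fam_mult f g n) \<beta> (\<lambda>H. L H * g n \<beta> + f n \<beta> * M H)
        (C * entry_norm (g n \<beta>) + entry_norm (f n \<beta>) * C')"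
      by (rule frechet_at_cong) (use n in \<open>auto simp: fam_apply\<close>)
    then show "\<exists>L C. frechet_at n (fam_mult f g n) \<beta> L C" by blast
  next
    fix m n :: nat and \<beta> \<beta>' :: "'a mat"
    assume *: "m \<ge> 1" "n \<ge> 1" "\<beta> \<in> carrier_mat m m" "\<beta>' \<in> carrier_mat n n"
    have "(f m \<beta> \<oplus>\<^sub>m f n \<beta>') * (g m \<beta> \<oplus>\<^sub>m g n \<beta>') = f m \<beta> * g m \<beta> \<oplus>\<^sub>m f n \<beta>' * g n \<beta>'"
      using * fg unfolding dsum_def
      by (subst mult_four_block_mat[of _ m m _ n _ n _ _ m _ n])
        (auto simp: square_mult_carrier left_mult_zero_mat right_mult_zero_mat)
    then show "fam_mult f g (m + n) (\<beta> \<oplus>\<^sub>m \<beta>') = fam_mult f g m \<beta> \<oplus>\<^sub>m fam_mult f g n \<beta>'"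
      using * by (simp add: fam_apply AM_D(2)[OF assms(1)] AM_D(2)[OF assms(2)])
  next
    fix n and s t :: "complex mat" and \<beta> :: "'a mat"
    assume *: "n \<ge> 1" "s \<in> carrier_mat n n" "t \<in> carrier_mat n n" "s * t = 1\<^sub>m n" "t * s = 1\<^sub>m n"
      "\<beta> \<in> carrier_mat n n"
    have c: "f n \<beta> \<in> carrier_mat n n" "g n \<beta> \<in> carrier_mat n n" using * fg by auto
    have "s * f n \<beta> * t * (s * g n \<beta> * t) = s * f n \<beta> * (t * s) * (g n \<beta> * t)"
      using *(1-3,6) c by (simp add: assoc_mult_mat[where n\<^sub>1 = n and n\<^sub>2 = n and n\<^sub>3 = n and n\<^sub>4 = n]
        square_mult_carrier)
    also have "\<dots> = s * (f n \<beta> * g n \<beta>) * t"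
      using * c by (simp add: assoc_mult_mat[where n\<^sub>1 = n and n\<^sub>2 = n and n\<^sub>3 = n and n\<^sub>4 = n]
        square_mult_carrier)
    moreover have "scal s * \<beta> * scal t \<in> carrier_mat n n" using * by (intro square_mult_carrier) auto
    ultimately show "fam_mult f g n (scal s * \<beta> * scal t) = s * fam_mult f g n \<beta> * t"
      using * by (simp add: fam_apply AM_D(3)[OF assms(1)] AM_D(3)[OF assms(2)])
  }
qed

lemma AM_zfam:
  assumes "\<phi> \<in> top_dual"
  shows "zfam \<phi> \<in> AM"
proof (rule AM_I)
  fix n :: nat and \<beta> :: "'a mat" assume n: "n \<ge> 1" "\<beta> \<in> carrier_mat n n"
  obtain C where "frechet_at n (map_mat \<phi>) \<beta> (map_mat \<phi>) C"
    using frechet_at_functional[OF assms n(2)] ..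
  then have "frechet_at n (zfam \<phi> n) \<beta> (map_mat \<phi>) C"
    by (rule frechet_at_cong) (use n in \<open>auto simp: fam_apply\<close>)
  then show "\<exists>L C. frechet_at n (zfam \<phi> n) \<beta> L C" by blast
next
  fix m n :: nat and \<beta> \<beta>' :: "'a mat"
  assume *: "m \<ge> 1" "n \<ge> 1" "\<beta> \<in> carrier_mat m m" "\<beta>' \<in> carrier_mat n n"
  have "map_mat \<phi> (\<beta> \<oplus>\<^sub>m \<beta>') = map_mat \<phi> \<beta> \<oplus>\<^sub>m map_mat \<phi> \<beta>'"
    using * top_dualD(3)[OF assms] unfolding dsum_def by (intro eq_matI) auto
  then show "zfam \<phi> (m + n) (\<beta> \<oplus>\<^sub>m \<beta>') = zfam \<phi> m \<beta> \<oplus>\<^sub>m zfam \<phi> n \<beta>'"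
    using * by (simp add: fam_apply)
next
  fix n and s t :: "complex mat" and \<beta> :: "'a mat"
  assume *: "n \<ge> 1" "s \<in> carrier_mat n n" "t \<in> carrier_mat n n" "\<beta> \<in> carrier_mat n n"
  have left: "map_mat \<phi> (scal s * \<gamma>) = s * map_mat \<phi> \<gamma>" if "\<gamma> \<in> carrier_mat n n" for \<gamma>
  proof (rule eq_matI)
    fix i j assume "i < dim_row (s * map_mat \<phi> \<gamma>)" "j < dim_col (s * map_mat \<phi> \<gamma>)"
    then have ij: "i < n" "j < n" using * that by auto
    then show "map_mat \<phi> (scal s * \<gamma>) $$ (i, j) = (s * map_mat \<phi> \<gamma>) $$ (i, j)"
      using * that mult_mat_entry[of "scal s" n n \<gamma> n i j] mult_mat_entry[of s n n "map_mat \<phi> \<gamma>" n i j]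
      by (simp add: top_dualD[OF assms] scal_def mult_scaleC_left del: index_mult_mat(1))
  qed (use * that in \<open>auto simp: scal_def\<close>)
  have right: "map_mat \<phi> (\<gamma> * scal t) = map_mat \<phi> \<gamma> * t" if "\<gamma> \<in> carrier_mat n n" for \<gamma>
  proof (rule eq_matI)
    fix i j assume "i < dim_row (map_mat \<phi> \<gamma> * t)" "j < dim_col (map_mat \<phi> \<gamma> * t)"
    then have ij: "i < n" "j < n" using * that by auto
    then show "map_mat \<phi> (\<gamma> * scal t) $$ (i, j) = (map_mat \<phi> \<gamma> * t) $$ (i, j)"
      using * that mult_mat_entry[of \<gamma> n n "scal t" n i j] mult_mat_entry[of "map_mat \<phi> \<gamma>" n n t n i j]
      by (simp add: top_dualD[OF assms] scal_def mult_scaleC_right mult.commute del: index_mult_mat(1))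
  qed (use * that in \<open>auto simp: scal_def\<close>)
  have c: "scal s * \<beta> \<in> carrier_mat n n" "scal s * \<beta> * scal t \<in> carrier_mat n n"
    using * by (auto intro!: square_mult_carrier)
  show "zfam \<phi> n (scal s * \<beta> * scal t) = s * zfam \<phi> n \<beta> * t"
    using * c by (simp add: fam_apply left right)
qed simp

lemma fam_smult_alt: "f \<in> Fam \<Longrightarrow> fam_smult c f = fam_mult (fam_smult c fam_one) f"
  by (simp add: fam_mult_smult fam_mult_one)

text \<open>Spans and generated subalgebras are intersections of subspaces of \<open>A(M(B))\<close>. As \<open>A(M(B))\<close> itself is a
  subalgebra, they are intersections of nonempty collections.\<close>

lemma unital_subalgebra_AM: "unital_subalgebra AM"
proof -
  have "fam_smult 0 fam_one = (fam_zero :: 'a family)" "fam_smult 1 fam_one = (fam_one :: 'a family)"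
    by (rule Fam_eqI; simp add: fam_entry)+
  then have "(fam_zero :: 'a family) \<in> AM" "(fam_one :: 'a family) \<in> AM"
    using AM_const[of 0] AM_const[of 1] by metis+
  moreover have "fam_smult c f \<in> AM" if "f \<in> AM" for c and f :: "'a family"
    using AM_mult[OF AM_const that] fam_smult_alt[OF AM_Fam[OF that]] by simp
  ultimately show ?thesis
    unfolding unital_subalgebra_def linear_subspace_def using AM_add AM_mult by auto
qed


section \<open>Linear spans and words\<close>

lemma linear_subspaceD:
  assumes "linear_subspace V"
  shows "f \<in> V \<Longrightarrow> f \<in> AM" "f \<in> V \<Longrightarrow> f \<in> Fam" "fam_zero \<in> V"
    "f \<in> V \<Longrightarrow> g \<in> V \<Longrightarrow> fam_add f g \<in> V" "f \<in> V \<Longrightarrow> fam_smult c f \<in> V"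
    "f \<in> V \<Longrightarrow> g \<in> V \<Longrightarrow> fam_diff f g \<in> V"
proof -
  show "f \<in> V \<Longrightarrow> f \<in> AM" "f \<in> V \<Longrightarrow> f \<in> Fam" "fam_zero \<in> V"
    "f \<in> V \<Longrightarrow> g \<in> V \<Longrightarrow> fam_add f g \<in> V" "f \<in> V \<Longrightarrow> fam_smult c f \<in> V"
    using assms AM_Fam unfolding linear_subspace_def by auto
  show "fam_diff f g \<in> V" if "f \<in> V" "g \<in> V"
    using assms that AM_Fam unfolding linear_subspace_def by (subst fam_diff_alt) auto
qed

lemma unital_subalgebraD:
  assumes "unital_subalgebra V"
  shows "linear_subspace V" "fam_one \<in> V" "f \<in> V \<Longrightarrow> g \<in> V \<Longrightarrow> fam_mult f g \<in> V"
  using assms unfolding unital_subalgebra_def by auto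

lemma linear_subspace_hull:
  assumes "S \<subseteq> AM"
  shows "linear_subspace (linear_subspace hull S)"
proof -
  have "linear_subspace hull S \<subseteq> AM"
    using assms unital_subalgebraD(1)[OF unital_subalgebra_AM] by (rule hull_minimal)
  then show ?thesis
    by (subst linear_subspace_def) (auto simp: hull_def linear_subspace_def)
qed

lemma unital_subalgebra_hull:
  assumes "S \<subseteq> AM"
  shows "unital_subalgebra (unital_subalgebra hull S)"
proof -
  have "unital_subalgebra hull S \<subseteq> AM" using assms unital_subalgebra_AM by (rule hull_minimal)
  then show ?thesis
    by (subst unital_subalgebra_def, subst linear_subspace_def)
      (auto simp: hull_def linear_subspace_def unital_subalgebra_def)
qed

lemma span_induct [consumes 2, case_names zero add smult base]:
  assumes "f \<in> linear_subspace hull S" "S \<subseteq> AM"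
    and "P fam_zero"
    and add: "\<And>f g. \<lbrakk>f \<in> linear_subspace hull S; g \<in> linear_subspace hull S; P f; P g\<rbrakk> \<Longrightarrow> P (fam_add f g)"
    and "\<And>c f. \<lbrakk>f \<in> linear_subspace hull S; P f\<rbrakk> \<Longrightarrow> P (fam_smult c f)"
    and "\<And>f. f \<in> S \<Longrightarrow> P f"
  shows "P f"
proof -
  have "linear_subspace {f \<in> linear_subspace hull S. P f}"
    using linear_subspace_hull[OF assms(2)] assms(3-5) by (auto simp: linear_subspace_def)
  moreover have "S \<subseteq> {f \<in> linear_subspace hull S. P f}"
    using assms(6) by (auto intro: hull_inc)
  ultimately have "linear_subspace hull S \<subseteq> {f \<in> linear_subspace hull S. P f}"
    by (intro hull_minimal)
  then show ?thesis using assms(1) by blast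
qed

text \<open>The families \<open>n, \<beta> \<mapsto> \<Sum>\<^sub>i\<^sub>\<in>\<^sub>I F\<^sub>i(\<beta>)\<close>.\<close>

definition fam_sum :: "('i \<Rightarrow> 'b::complex_unital_banach_algebra family) \<Rightarrow> 'i set \<Rightarrow> 'b family" where
  "fam_sum F I = family (\<lambda>n \<beta>. mat n n (\<lambda>(i, j). \<Sum>x\<in>I. F x n \<beta> $$ (i, j)))"

lemma fam_sum_Fam [simp]: "fam_sum F I \<in> Fam"
  unfolding fam_sum_def by (rule family_in_Fam) simp

lemma fam_sum_entry:
  assumes "n \<ge> 1" "\<beta> \<in> carrier_mat n n" "i < n" "j < n"
  shows "fam_sum F I n \<beta> $$ (i, j) = (\<Sum>x\<in>I. F x n \<beta> $$ (i, j))"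
  using assms by (simp add: fam_sum_def)

lemma fam_sum_empty: "fam_sum F {} = fam_zero"
  by (rule Fam_eqI) (auto simp: fam_entry fam_sum_entry)

lemma fam_sum_insert:
  assumes "finite I" "x \<notin> I" "F x \<in> Fam"
  shows "fam_sum F (insert x I) = fam_add (F x) (fam_sum F I)"
  using assms by (intro Fam_eqI) (auto simp: fam_entry fam_sum_entry)

lemma fam_sum_in:
  assumes "linear_subspace V" "finite I" "\<And>x. x \<in> I \<Longrightarrow> F x \<in> V"
  shows "fam_sum F I \<in> V"
  using assms(2,3)
proof (induction I rule: finite_induct)
  case empty
  then show ?case using linear_subspaceD(3)[OF assms(1)] by (simp add: fam_sum_empty)
next
  case (insert x I)
  then show ?case using linear_subspaceD(2,4)[OF assms(1)] by (simp add: fam_sum_insert)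
qed

text \<open>The monomial \<open>z(\<phi>\<^sub>1) \<cdots> z(\<phi>\<^sub>k)\<close> of the list \<open>[\<phi>\<^sub>1, \<dots>, \<phi>\<^sub>k]\<close>.\<close>

primrec zword :: "('b::complex_unital_banach_algebra \<Rightarrow> complex) list \<Rightarrow> 'b family" where
  "zword [] = fam_one"
| "zword (\<phi> # w) = fam_mult (zfam \<phi>) (zword w)"

lemma zword_Fam [simp]: "zword w \<in> Fam"
  by (induction w) auto

lemma zword_append: "zword (u @ v) = fam_mult (zword u) (zword v)"
  by (induction u) (simp_all add: fam_mult_one fam_mult_assoc)

lemma zword_AM: "set w \<subseteq> top_dual \<Longrightarrow> zword w \<in> AM"
  using unital_subalgebra_AM
  by (induction w) (auto simp: unital_subalgebra_def intro: AM_mult AM_zfam)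

lemma zwords_AM: "S \<subseteq> top_dual \<Longrightarrow> zword ` lists S \<subseteq> AM"
  by (auto intro!: zword_AM)

lemma span_zwords_mult:
  assumes S: "S \<subseteq> top_dual"
    and f: "f \<in> linear_subspace hull (zword ` lists S)" and g: "g \<in> linear_subspace hull (zword ` lists S)"
  shows "fam_mult f g \<in> linear_subspace hull (zword ` lists S)"
proof -
  note AM = zwords_AM[OF S]
  note D = linear_subspaceD[OF linear_subspace_hull[OF AM]]
  have base: "fam_mult (zword u) g \<in> linear_subspace hull (zword ` lists S)" if u: "u \<in> lists S" for u
    using g AM
  proof (induction rule: span_induct)
    case zero
    then show ?case by (simp add: fam_mult_zero D)
  next
    case (add f g)
    then show ?case by (simp add: fam_mult_distrib D)
  next
    case (smult c f)
    then show ?case by (simp add: fam_mult_smult D)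
  next
    case (base f)
    then obtain v where "v \<in> lists S" "f = zword v" by auto
    then show ?case using u by (auto simp: zword_append[symmetric] intro!: hull_inc imageI)
  qed
  show ?thesis using f AM
  proof (induction rule: span_induct)
    case zero
    then show ?case using g by (simp add: fam_mult_zero D)
  next
    case (add f h)
    then show ?case using g by (simp add: fam_mult_distrib D)
  next
    case (smult c f)
    then show ?case using g by (simp add: fam_mult_smult D)
  qed (use base in auto)
qed

text \<open>The span of the words over \<open>S\<close> is closed under products because words can be concatenated.\<close>

lemma subalgebra_hull_eq_span:
  assumes S: "S \<subseteq> top_dual"
  shows "unital_subalgebra hull (zfam ` S) = linear_subspace hull (zword ` lists S)"
proof
  have "zfam ` S \<subseteq> AM" using S by (auto intro: AM_zfam)
  note A = unital_subalgebra_hull[OF this]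
  have "zword w \<in> unital_subalgebra hull (zfam ` S)" if "w \<in> lists S" for w
    using that
  proof (induction w)
    case Nil
    then show ?case using unital_subalgebraD(2)[OF A] by simp
  next
    case (Cons \<phi> w)
    then have "zfam \<phi> \<in> unital_subalgebra hull (zfam ` S)" by (auto intro: hull_inc)
    then show ?case using unital_subalgebraD(3)[OF A] Cons by simp
  qed
  then show "linear_subspace hull (zword ` lists S) \<subseteq> unital_subalgebra hull (zfam ` S)"
    using unital_subalgebraD(1)[OF A] by (intro hull_minimal) auto
next
  have "zfam \<phi> \<in> linear_subspace hull (zword ` lists S)" if "\<phi> \<in> S" for \<phi>
  proof -
    have "zword [\<phi>] \<in> linear_subspace hull (zword ` lists S)"
      using that by (intro hull_inc imageI) auto
    then show ?thesis by (simp add: fam_mult_one)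
  qed
  moreover have "fam_one \<in> linear_subspace hull (zword ` lists S)"
  proof -
    have "zword [] \<in> linear_subspace hull (zword ` lists S)" by (intro hull_inc imageI) auto
    then show ?thesis by simp
  qed
  ultimately show "unital_subalgebra hull (zfam ` S) \<subseteq> linear_subspace hull (zword ` lists S)"
    using linear_subspace_hull[OF zwords_AM[OF S]] span_zwords_mult[OF S]
    by (intro hull_minimal) (auto simp: unital_subalgebra_def)
qed


section \<open>The cyclic derivative on words\<close>

text \<open>The upper right block of the monomial of a word at \<open>[\<beta>, \<epsilon> e\<^sub>b\<^sub>c \<otimes> 1; 0, \<beta>']\<close>, divided by
  \<open>\<epsilon>\<close>.\<close>

primrec offdiag :: "nat \<Rightarrow> nat \<Rightarrow> 'b::complex_unital_banach_algebra mat \<Rightarrow> 'b mat \<Rightarrow> nat \<Rightarrow> nat \<Rightarrow>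
    ('b \<Rightarrow> complex) list \<Rightarrow> complex mat" where
  "offdiag m n \<beta> \<beta>' b c [] = 0\<^sub>m m n"
| "offdiag m n \<beta> \<beta>' b c (\<phi> # w) =
     map_mat \<phi> \<beta> * offdiag m n \<beta> \<beta>' b c w + \<phi> 1 \<cdot>\<^sub>m (mat_unit m n b c * zword w n \<beta>')"

lemma mat_unit_carrier [simp]: "mat_unit m n b c \<in> carrier_mat m n"
  by (simp add: mat_unit_def)

lemma offdiag_carrier [simp]:
  assumes "n \<ge> 1" "\<beta> \<in> carrier_mat m m" "\<beta>' \<in> carrier_mat n n"
  shows "offdiag m n \<beta> \<beta>' b c w \<in> carrier_mat m n"
  using assms
  by (induction w) (auto intro!: add_carrier_mat mult_carrier_mat smult_carrier_mat
    intro: mult_carrier_mat[of _ m n] mult_carrier_mat[of _ m m])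

text \<open>The monomials of words are block triangular on block triangular matrices, and the off-diagonal
  block is exactly linear in \<open>\<epsilon>\<close>.\<close>

lemma zword_block:
  assumes "m \<ge> 1" "n \<ge> 1" "\<beta> \<in> carrier_mat m m" "\<beta>' \<in> carrier_mat n n" and w: "set w \<subseteq> top_dual"
  shows "zword w (m + n) (four_block_mat \<beta> (scal (\<epsilon> \<cdot>\<^sub>m mat_unit m n b c)) (0\<^sub>m n m) \<beta>') =
    four_block_mat (zword w m \<beta>) (\<epsilon> \<cdot>\<^sub>m offdiag m n \<beta> \<beta>' b c w) (0\<^sub>m n m) (zword w n \<beta>')"
  using w
proof (induction w)
  case Nil
  show ?case using assms by (intro eq_matI) (auto simp: fam_apply)
next
  case (Cons \<phi> w)
  let ?X = "four_block_mat \<beta> (scal (\<epsilon> \<cdot>\<^sub>m mat_unit m n b c)) (0\<^sub>m n m) \<beta>'"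
  let ?U = "offdiag m n \<beta> \<beta>' b c w"
  have phi: "\<phi> \<in> top_dual" using Cons by simp
  have X: "?X \<in> carrier_mat (m + n) (m + n)" using assms by auto
  have c: "map_mat \<phi> \<beta> \<in> carrier_mat m m" "map_mat \<phi> \<beta>' \<in> carrier_mat n n"
    "zword w m \<beta> \<in> carrier_mat m m" "zword w n \<beta>' \<in> carrier_mat n n" "?U \<in> carrier_mat m n"
    using assms by auto
  have "map_mat \<phi> ?X = four_block_mat (map_mat \<phi> \<beta>) ((\<epsilon> * \<phi> 1) \<cdot>\<^sub>m mat_unit m n b c) (0\<^sub>m n m) (map_mat \<phi> \<beta>')"
    using assms by (intro eq_matI) (auto simp: scal_def mat_unit_def top_dualD[OF phi])
  then have "zword (\<phi> # w) (m + n) ?X =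
      four_block_mat (map_mat \<phi> \<beta>) ((\<epsilon> * \<phi> 1) \<cdot>\<^sub>m mat_unit m n b c) (0\<^sub>m n m) (map_mat \<phi> \<beta>') *
      four_block_mat (zword w m \<beta>) (\<epsilon> \<cdot>\<^sub>m ?U) (0\<^sub>m n m) (zword w n \<beta>')"
    using Cons assms X by (simp add: fam_apply)
  also have "\<dots> = four_block_mat
      (map_mat \<phi> \<beta> * zword w m \<beta> + ((\<epsilon> * \<phi> 1) \<cdot>\<^sub>m mat_unit m n b c) * 0\<^sub>m n m)
      (map_mat \<phi> \<beta> * (\<epsilon> \<cdot>\<^sub>m ?U) + ((\<epsilon> * \<phi> 1) \<cdot>\<^sub>m mat_unit m n b c) * zword w n \<beta>')
      (0\<^sub>m n m * zword w m \<beta> + map_mat \<phi> \<beta>' * 0\<^sub>m n m)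
      (0\<^sub>m n m * (\<epsilon> \<cdot>\<^sub>m ?U) + map_mat \<phi> \<beta>' * zword w n \<beta>')"
    by (rule mult_four_block_mat[of _ m m _ n _ n _ _ m _ n]) (use c in auto)
  finally have result: "zword (\<phi> # w) (m + n) ?X = \<dots>" .
  have smult_smult: "(x * y) \<cdot>\<^sub>m A = x \<cdot>\<^sub>m (y \<cdot>\<^sub>m A)" for x y and A :: "complex mat"
    by (intro eq_matI) auto
  note result
  also have "map_mat \<phi> \<beta> * (\<epsilon> \<cdot>\<^sub>m ?U) + ((\<epsilon> * \<phi> 1) \<cdot>\<^sub>m mat_unit m n b c) * zword w n \<beta>' =
      \<epsilon> \<cdot>\<^sub>m offdiag m n \<beta> \<beta>' b c (\<phi> # w)"
    using c mat_unit_carrier[of m n b c]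
    by (simp add: mult_smult_distrib[of _ m m _ n] mult_smult_assoc_mat[of _ m n _ n]
      add_smult_distrib_left_mat[of _ m n] mult_carrier_mat[of _ m m _ n] mult_carrier_mat[of _ m n _ n]
      smult_smult)
  also have "map_mat \<phi> \<beta> * zword w m \<beta> + ((\<epsilon> * \<phi> 1) \<cdot>\<^sub>m mat_unit m n b c) * 0\<^sub>m n m = zword (\<phi> # w) m \<beta>"
    using c assms by (simp add: fam_apply right_mult_zero_mat[of _ m n] square_mult_carrier)
  also have "0\<^sub>m n m * zword w m \<beta> + map_mat \<phi> \<beta>' * 0\<^sub>m n m = 0\<^sub>m n m"
    using c by (simp add: right_mult_zero_mat[of _ n n] left_mult_zero_mat[of _ m m])
  also have "0\<^sub>m n m * (\<epsilon> \<cdot>\<^sub>m ?U) + map_mat \<phi> \<beta>' * zword w n \<beta>' = zword (\<phi> # w) n \<beta>'"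
    using c assms by (simp add: fam_apply left_mult_zero_mat[of _ m n] square_mult_carrier)
  finally show ?case .
qed

lemma offdiag_entry:
  assumes "m \<ge> 1" "n \<ge> 1" "\<beta> \<in> carrier_mat m m" "\<beta>' \<in> carrier_mat n n"
    and "a < m" "b < m" "c < n" "d < n"
  shows "offdiag m n \<beta> \<beta>' b c w $$ (a, d) =
    (\<Sum>i<length w. (w ! i) 1 * (zword (take i w) m \<beta> $$ (a, b) * zword (drop (Suc i) w) n \<beta>' $$ (c, d)))"
  using assms(5)
proof (induction w arbitrary: a)
  case Nil
  then show ?case using assms by simp
next
  case (Cons \<phi> w)
  let ?U = "offdiag m n \<beta> \<beta>' b c w"
  have c: "map_mat \<phi> \<beta> \<in> carrier_mat m m" "zword w n \<beta>' \<in> carrier_mat n n" "?U \<in> carrier_mat m n"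
    using assms by auto
  have "(map_mat \<phi> \<beta> * ?U) $$ (a, d) = (\<Sum>l<m. \<phi> (\<beta> $$ (a, l)) * ?U $$ (l, d))"
    using c Cons.prems assms by (subst mult_mat_entry[OF c(1,3)]) auto
  also have "\<dots> = (\<Sum>l<m. \<Sum>i<length w. \<phi> (\<beta> $$ (a, l)) * ((w ! i) 1 *
      (zword (take i w) m \<beta> $$ (l, b) * zword (drop (Suc i) w) n \<beta>' $$ (c, d))))"
    using Cons.IH by (simp add: sum_distrib_left)
  also have "\<dots> = (\<Sum>i<length w. (w ! i) 1 *
      (zword (\<phi> # take i w) m \<beta> $$ (a, b) * zword (drop (Suc i) w) n \<beta>' $$ (c, d)))"
    using Cons.prems assms
    by (subst sum.swap) (simp add: fam_entry sum_distrib_left sum_distrib_right mult_ac)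
  finally have 1: "(map_mat \<phi> \<beta> * ?U) $$ (a, d) = \<dots>" .
  have "(mat_unit m n b c * zword w n \<beta>') $$ (a, d) = (\<Sum>l<n. (if a = b \<and> l = c then 1 else 0) * zword w n \<beta>' $$ (l, d))"
    using c Cons.prems assms by (subst mult_mat_entry[OF mat_unit_carrier c(2)]) (auto simp: mat_unit_def)
  also have "\<dots> = (\<Sum>l<n. if l = c then (if a = b then zword w n \<beta>' $$ (c, d) else 0) else 0)"
    by (intro sum.cong) auto
  finally have 2: "(mat_unit m n b c * zword w n \<beta>') $$ (a, d) = (if a = b then 1 else 0) * zword w n \<beta>' $$ (c, d)"
    using assms by simp
  have "offdiag m n \<beta> \<beta>' b c (\<phi> # w) $$ (a, d) =
      (map_mat \<phi> \<beta> * ?U) $$ (a, d) + \<phi> 1 * (mat_unit m n b c * zword w n \<beta>') $$ (a, d)"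
    using c Cons.prems assms by (simp add: mat_unit_def del: index_mult_mat(1))
  then show ?case
    unfolding 1 2 using Cons.prems assms
    by (simp add: sum.lessThan_Suc_shift fam_entry del: sum.lessThan_Suc zword.simps(2))
qed


text \<open>The function of \<open>\<epsilon>\<close> whose derivative at \<open>0\<close> is a coefficient of \<open>\<partial>f\<close>.\<close>

definition perturbed_entry where
  "perturbed_entry f n \<beta> a b c d \<epsilon> =
     f (n + n) (four_block_mat \<beta> (scal (\<epsilon> \<cdot>\<^sub>m mat_unit n n b c)) (0\<^sub>m n n) \<beta>) $$ (a, n + d)"

lemma fdq_perturbed_entry: "fdq f n n \<beta> \<beta> a b c d = deriv (perturbed_entry f n \<beta> a b c d) 0"
  by (simp add: fdq_def perturbed_entry_def[abs_def])

lemma perturbed_entry_zword: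
  assumes "n \<ge> 1" "\<beta> \<in> carrier_mat n n" "set w \<subseteq> top_dual" "a < n" "d < n"
  shows "perturbed_entry (zword w) n \<beta> a b c d = (\<lambda>\<epsilon>. \<epsilon> * offdiag n n \<beta> \<beta> b c w $$ (a, d))"
  using assms offdiag_carrier[of n \<beta> n \<beta> b c w]
  by (auto simp: perturbed_entry_def[abs_def] zword_block simp del: offdiag_carrier)

lemma perturbed_entry_lin:
  assumes "n \<ge> 1" "\<beta> \<in> carrier_mat n n" "a < n" "d < n" "f \<in> Fam" "g \<in> Fam"
  shows "perturbed_entry (fam_add f g) n \<beta> a b c d =
      (\<lambda>\<epsilon>. perturbed_entry f n \<beta> a b c d \<epsilon> + perturbed_entry g n \<beta> a b c d \<epsilon>)"
    "perturbed_entry (fam_smult x f) n \<beta> a b c d = (\<lambda>\<epsilon>. x * perturbed_entry f n \<beta> a b c d \<epsilon>)"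
    "perturbed_entry fam_zero n \<beta> a b c d = (\<lambda>\<epsilon>. 0)"
  using assms by (auto simp: perturbed_entry_def[abs_def] fam_entry)

lemma Z_dual_subalgebra: "unital_subalgebra Z_dual"
  unfolding Z_dual_def by (rule unital_subalgebra_hull) (auto intro: AM_zfam)

lemmas Z_dual_subspace = unital_subalgebraD(1)[OF Z_dual_subalgebra]
lemmas Z_dualD = linear_subspaceD[OF Z_dual_subspace]

lemma Z_dual_span: "Z_dual = linear_subspace hull (zword ` lists top_dual)"
  by (simp add: Z_dual_def subalgebra_hull_eq_span)

lemma zword_Z_dual: "set w \<subseteq> top_dual \<Longrightarrow> zword w \<in> Z_dual"
  unfolding Z_dual_span by (intro hull_inc imageI) auto

lemma Z_dual_induct [consumes 1, case_names zero add smult word]: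
  assumes "f \<in> Z_dual" "P fam_zero"
    "\<And>f g. \<lbrakk>f \<in> Z_dual; g \<in> Z_dual; P f; P g\<rbrakk> \<Longrightarrow> P (fam_add f g)"
    "\<And>c f. \<lbrakk>f \<in> Z_dual; P f\<rbrakk> \<Longrightarrow> P (fam_smult c f)"
    "\<And>w. set w \<subseteq> top_dual \<Longrightarrow> P (zword w)"
  shows "P f"
  using assms(1)[unfolded Z_dual_span] zwords_AM[OF subset_refl]
  by (rule span_induct) (use assms in \<open>auto simp: Z_dual_span[symmetric] in_lists_conv_set subset_eq\<close>)

lemma perturbed_entry_differentiable:
  assumes "f \<in> Z_dual" "n \<ge> 1" "\<beta> \<in> carrier_mat n n" "a < n" "d < n"
  shows "perturbed_entry f n \<beta> a b c d field_differentiable at 0"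
  using assms(1)
proof (induction rule: Z_dual_induct)
  case zero
  then show ?case using assms by (simp add: perturbed_entry_lin(3)[where f = fam_zero and g = fam_zero])
next
  case (add f g)
  then have "f \<in> Fam" "g \<in> Fam" using Z_dualD(2) by auto
  then show ?case using assms add by (simp add: perturbed_entry_lin(1) field_differentiable_add)
next
  case (smult x f)
  then have "f \<in> Fam" using Z_dualD(2) by auto
  then show ?case using assms smult
    by (simp add: perturbed_entry_lin(2)[where g = fam_zero] field_differentiable_mult)
next
  case (word w)
  then show ?case using assms by (auto simp: perturbed_entry_zword intro!: derivative_intros)
qed

lemma cyc_deriv_Fam [simp]: "cyc_deriv f \<in> Fam"
  unfolding cyc_deriv_def by (rule family_in_Fam) (simp add: tensor_mult_def)

lemma cyc_deriv_entry:
  assumes "n \<ge> 1" "\<beta> \<in> carrier_mat n n" "i < n" "j < n"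
  shows "cyc_deriv f n \<beta> $$ (i, j) = (\<Sum>k<n. deriv (perturbed_entry f n \<beta> k j i k) 0)"
  using assms by (simp add: cyc_deriv_def tensor_mult_def tensor_flip_def fdq_perturbed_entry)

lemma cyc_deriv_add:
  assumes "f \<in> Z_dual" "g \<in> Z_dual"
  shows "cyc_deriv (fam_add f g) = fam_add (cyc_deriv f) (cyc_deriv g)"
  using assms
  by (intro Fam_eqI) (auto simp: fam_entry cyc_deriv_entry perturbed_entry_lin Z_dualD
    perturbed_entry_differentiable sum.distrib)

lemma cyc_deriv_smult:
  assumes "f \<in> Z_dual"
  shows "cyc_deriv (fam_smult c f) = fam_smult c (cyc_deriv f)"
  using assms
  by (intro Fam_eqI) (auto simp: fam_entry cyc_deriv_entry perturbed_entry_lin(2)[where g = fam_zero] Z_dualD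
    perturbed_entry_differentiable sum_distrib_left)

lemma cyc_deriv_zero: "cyc_deriv fam_zero = fam_zero"
  by (rule Fam_eqI) (auto simp: fam_entry cyc_deriv_entry
    perturbed_entry_lin(3)[where f = fam_zero and g = fam_zero])

text \<open>Flipping and multiplying out \<open>\<partial>\<close> of a word turns the part before the \<open>i\<close>th letter and the part after
  it into the rotated word without this letter.\<close>

lemma cyc_deriv_zword:
  assumes "set w \<subseteq> top_dual"
  shows "cyc_deriv (zword w) =
    fam_sum (\<lambda>i. fam_smult ((w ! i) 1) (zword (drop (Suc i) w @ take i w))) {..<length w}"
proof (rule Fam_eqI)
  fix n i j and \<beta> :: "'a mat"
  assume *: "n \<ge> 1" "\<beta> \<in> carrier_mat n n" "i < n" "j < n"
  have "cyc_deriv (zword w) n \<beta> $$ (i, j) = (\<Sum>k<n. offdiag n n \<beta> \<beta> j i w $$ (k, k))"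
    using * assms by (simp add: cyc_deriv_entry perturbed_entry_zword)
  also have "\<dots> = (\<Sum>l<length w. \<Sum>k<n. (w ! l) 1 *
      (zword (take l w) n \<beta> $$ (k, j) * zword (drop (Suc l) w) n \<beta> $$ (i, k)))"
    using * by (subst sum.swap) (simp add: offdiag_entry)
  also have "\<dots> = (\<Sum>l<length w. (w ! l) 1 * zword (drop (Suc l) w @ take l w) n \<beta> $$ (i, j))"
    using * by (simp add: zword_append fam_entry sum_distrib_left mult_ac)
  finally show "cyc_deriv (zword w) n \<beta> $$ (i, j) =
      fam_sum (\<lambda>i. fam_smult ((w ! i) 1) (zword (drop (Suc i) w @ take i w))) {..<length w} n \<beta> $$ (i, j)"
    using * by (simp add: fam_sum_entry fam_entry)
qed auto

lemma cyc_deriv_rotate1: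
  assumes "set (\<phi> # w) \<subseteq> top_dual"
  shows "cyc_deriv (zword (\<phi> # w)) = cyc_deriv (zword (w @ [\<phi>]))"
proof (rule Fam_eqI)
  fix n i j and \<beta> :: "'a mat"
  assume *: "n \<ge> 1" "\<beta> \<in> carrier_mat n n" "i < n" "j < n"
  have w: "set (w @ [\<phi>]) \<subseteq> top_dual" using assms by auto
  have "cyc_deriv (zword (\<phi> # w)) n \<beta> $$ (i, j) = \<phi> 1 * zword w n \<beta> $$ (i, j) +
      (\<Sum>l<length w. (w ! l) 1 * zword (drop (Suc l) w @ \<phi> # take l w) n \<beta> $$ (i, j))"
    unfolding cyc_deriv_zword[OF assms] fam_sum_entry[OF *] using *
    by (simp add: sum.lessThan_Suc_shift fam_entry del: sum.lessThan_Suc)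
  also have "\<dots> = cyc_deriv (zword (w @ [\<phi>])) n \<beta> $$ (i, j)"
    unfolding cyc_deriv_zword[OF w] fam_sum_entry[OF *] using *
    by (simp add: fam_entry nth_append)
  finally show "cyc_deriv (zword (\<phi> # w)) n \<beta> $$ (i, j) = cyc_deriv (zword (w @ [\<phi>])) n \<beta> $$ (i, j)" .
qed auto

lemma cyc_deriv_swap:
  assumes "set (u @ v) \<subseteq> top_dual"
  shows "cyc_deriv (zword (u @ v)) = cyc_deriv (zword (v @ u))"
  using assms
proof (induction u arbitrary: v)
  case (Cons \<phi> u)
  then show ?case using cyc_deriv_rotate1[of \<phi> "u @ v"] Cons.IH[of "v @ [\<phi>]"] by simp
qed simp


section \<open>Elements of the kernel of the cyclic derivative\<close>

lemma ker_cyc_deriv_subspace: "linear_subspace (ker_on cyc_deriv Z_dual)"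
proof -
  have "fam_add fam_zero fam_zero = (fam_zero :: 'a family)"
    and "fam_smult c fam_zero = (fam_zero :: 'a family)" for c
    by (rule Fam_eqI; simp add: fam_entry)+
  then show ?thesis
    unfolding ker_on_def
    by (subst linear_subspace_def) (auto simp: cyc_deriv_add cyc_deriv_smult cyc_deriv_zero Z_dualD)
qed

lemma Z_one_perp_span: "Z_one_perp = linear_subspace hull (zword ` lists {\<phi> \<in> top_dual. \<phi> 1 = 0})"
  unfolding Z_one_perp_def by (rule subalgebra_hull_eq_span) auto

lemma Z_one_perp_subset_ker: "Z_one_perp \<subseteq> ker_on cyc_deriv Z_dual"
  unfolding Z_one_perp_span
proof (rule hull_minimal)
  show "zword ` lists {\<phi> \<in> top_dual. \<phi> 1 = 0} \<subseteq> ker_on cyc_deriv (Z_dual :: 'a family set)"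
  proof (rule image_subsetI)
    fix w :: "('a \<Rightarrow> complex) list" assume "w \<in> lists {\<phi> \<in> top_dual. \<phi> 1 = 0}"
    then have w: "set w \<subseteq> top_dual" "\<forall>\<phi>\<in>set w. \<phi> 1 = 0" by auto
    have "cyc_deriv (zword w) = fam_zero"
      unfolding cyc_deriv_zword[OF w(1)]
      using w(2) by (intro Fam_eqI) (auto simp: fam_entry fam_sum_entry intro!: sum.neutral)
    then show "zword w \<in> ker_on cyc_deriv Z_dual"
      using w(1) by (simp add: ker_on_def zword_Z_dual)
  qed
qed (rule ker_cyc_deriv_subspace)

lemma Z_dual_mult: "f \<in> Z_dual \<Longrightarrow> g \<in> Z_dual \<Longrightarrow> fam_mult f g \<in> Z_dual"
  by (rule unital_subalgebraD(3)[OF Z_dual_subalgebra])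

lemma cyc_deriv_mult_commute:
  assumes f: "f \<in> Z_dual" and g: "g \<in> Z_dual"
  shows "cyc_deriv (fam_mult f g) = cyc_deriv (fam_mult g f)"
proof -
  have word: "cyc_deriv (fam_mult (zword u) g) = cyc_deriv (fam_mult g (zword u))"
    if u: "set u \<subseteq> top_dual" for u
    using g
  proof (induction rule: Z_dual_induct)
    case (word v)
    then show ?case using u by (simp add: zword_append[symmetric] cyc_deriv_swap)
  qed (use u zword_Z_dual[OF u] in \<open>simp_all add: fam_mult_zero fam_mult_distrib fam_mult_smult
      cyc_deriv_add cyc_deriv_smult Z_dual_mult Z_dualD(2)\<close>)
  show ?thesis
    using f
    by (induction rule: Z_dual_induct)
      (use g word in \<open>simp_all add: fam_mult_zero fam_mult_distrib fam_mult_smult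
        cyc_deriv_add cyc_deriv_smult Z_dual_mult Z_dualD(2)\<close>)
qed

lemma commutator_span_subset_ker: "commutator_span Z_dual \<subseteq> ker_on cyc_deriv Z_dual"
  unfolding commutator_span_def
proof (rule hull_minimal)
  show "{fam_diff (fam_mult f g) (fam_mult g f) | f g. f \<in> Z_dual \<and> g \<in> Z_dual}
      \<subseteq> ker_on cyc_deriv (Z_dual :: 'a family set)"
  proof clarify
    fix f g :: "'a family" assume fg: "f \<in> Z_dual" "g \<in> Z_dual"
    let ?c = "fam_diff (fam_mult f g) (fam_mult g f)"
    have m: "fam_mult f g \<in> Z_dual" "fam_mult g f \<in> Z_dual" using fg by (auto intro: Z_dual_mult)
    then have "cyc_deriv ?c = fam_add (cyc_deriv (fam_mult g f)) (fam_smult (-1) (cyc_deriv (fam_mult g f)))"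
      by (simp add: fam_diff_alt cyc_deriv_add cyc_deriv_smult cyc_deriv_mult_commute[OF fg] Z_dualD)
    also have "\<dots> = fam_zero"
      by (rule Fam_eqI) (auto simp: fam_entry)
    finally show "?c \<in> ker_on cyc_deriv Z_dual"
      using m by (simp add: ker_on_def Z_dualD)
  qed
qed (rule ker_cyc_deriv_subspace)

lemma commutator_span_subspace: "linear_subspace (commutator_span Z_dual)"
  unfolding commutator_span_def by (rule linear_subspace_hull) (auto intro!: Z_dualD Z_dual_mult)


section \<open>The grading by a functional\<close>

text \<open>The alphabet \<open>{\<theta>} \<union> 1\<^sup>\<bottom>\<close>, which spans \<open>B\<^sup>d\<close> if \<open>\<theta> \<in> B\<^sup>d\<close> and \<open>\<theta>(1) = 1\<close>.\<close>

abbreviation letters where "letters \<theta> \<equiv> insert \<theta> {\<phi> \<in> top_dual. \<phi> 1 = 0}"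

lemma top_dual_diff:
  assumes "\<phi> \<in> top_dual" "\<theta> \<in> top_dual"
  shows "(\<lambda>x. \<phi> x - c * \<theta> x) \<in> top_dual"
proof -
  have "bounded_linear \<phi>" "bounded_linear \<theta>" using assms by (auto simp: top_dual_def)
  then have "bounded_linear (\<lambda>x. \<phi> x - c * \<theta> x)"
    by (intro bounded_linear_sub bounded_linear_const_mult)
  then show ?thesis using assms by (auto simp: top_dual_def algebra_simps)
qed

lemma Z_dual_letters:
  assumes "\<theta> \<in> top_dual" "\<theta> 1 = 1"
  shows "Z_dual = linear_subspace hull (zword ` lists (letters \<theta>))"
proof -
  have sub: "letters \<theta> \<subseteq> top_dual" using assms by auto
  then have "zfam ` letters \<theta> \<subseteq> AM" by (auto intro: AM_zfam)
  note A = unital_subalgebra_hull[OF this]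
  have "zfam \<phi> \<in> unital_subalgebra hull (zfam ` letters \<theta>)" if "\<phi> \<in> top_dual" for \<phi>
  proof -
    define \<psi> where "\<psi> = (\<lambda>x. \<phi> x - \<phi> 1 * \<theta> x)"
    have "\<psi> \<in> letters \<theta>" using assms that by (auto simp: \<psi>_def top_dual_diff)
    then have "zfam \<psi> \<in> unital_subalgebra hull (zfam ` letters \<theta>)"
      "zfam \<theta> \<in> unital_subalgebra hull (zfam ` letters \<theta>)" by (auto intro: hull_inc)
    then have "fam_add (fam_smult (\<phi> 1) (zfam \<theta>)) (zfam \<psi>) \<in> unital_subalgebra hull (zfam ` letters \<theta>)"
      using linear_subspaceD(4,5)[OF unital_subalgebraD(1)[OF A]] by auto
    also have "fam_add (fam_smult (\<phi> 1) (zfam \<theta>)) (zfam \<psi>) = zfam \<phi>"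
      by (rule Fam_eqI) (auto simp: fam_entry \<psi>_def)
    finally show ?thesis .
  qed
  then have "Z_dual \<subseteq> unital_subalgebra hull (zfam ` letters \<theta>)"
    unfolding Z_dual_def using A by (intro hull_minimal) auto
  moreover have "unital_subalgebra hull (zfam ` letters \<theta>) \<subseteq> Z_dual"
    unfolding Z_dual_def using sub by (intro hull_mono) auto
  ultimately show ?thesis using subalgebra_hull_eq_span[OF sub] by simp
qed

text \<open>The span of the words over \<open>{\<theta>} \<union> 1\<^sup>\<bottom>\<close> in which \<open>\<theta>\<close> occurs exactly \<open>k\<close> times.\<close>

definition Z_degree :: "('b::complex_unital_banach_algebra \<Rightarrow> complex) \<Rightarrow> nat \<Rightarrow> 'b family set" where
  "Z_degree \<theta> k = linear_subspace hull (zword ` {w \<in> lists (letters \<theta>). count_list w \<theta> = k})"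

lemma degree_words_AM:
  "\<theta> \<in> top_dual \<Longrightarrow> zword ` {w \<in> lists (letters \<theta>). count_list w \<theta> = k} \<subseteq> AM"
  using zwords_AM[of "letters \<theta>"] by auto

lemma Z_degree_subspace: "\<theta> \<in> top_dual \<Longrightarrow> linear_subspace (Z_degree \<theta> k)"
  unfolding Z_degree_def by (rule linear_subspace_hull[OF degree_words_AM])

lemma Z_degree_induct [consumes 2, case_names zero add smult word]:
  assumes "f \<in> Z_degree \<theta> k" "\<theta> \<in> top_dual" "P fam_zero"
    "\<And>f g. \<lbrakk>f \<in> Z_degree \<theta> k; g \<in> Z_degree \<theta> k; P f; P g\<rbrakk> \<Longrightarrow> P (fam_add f g)"
    "\<And>c f. \<lbrakk>f \<in> Z_degree \<theta> k; P f\<rbrakk> \<Longrightarrow> P (fam_smult c f)"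
    "\<And>w. \<lbrakk>set w \<subseteq> letters \<theta>; count_list w \<theta> = k\<rbrakk> \<Longrightarrow> P (zword w)"
  shows "P f"
  using assms(1)[unfolded Z_degree_def] degree_words_AM[OF assms(2)]
proof (induction rule: span_induct)
  case (add f g)
  then show ?case using assms(4)[of f g] by (simp only: Z_degree_def)
next
  case (smult c f)
  then show ?case using assms(5)[of f c] by (simp only: Z_degree_def)
next
  case (base f)
  then show ?case using assms(6) by (auto simp: in_lists_conv_set subset_eq)
qed (rule assms(3))

lemma Z_degree_subset: "\<theta> \<in> top_dual \<Longrightarrow> \<theta> 1 = 1 \<Longrightarrow> Z_degree \<theta> k \<subseteq> Z_dual"
  unfolding Z_degree_def by (subst Z_dual_letters[of \<theta>]) (auto intro!: hull_mono)

lemma Z_degree_0: "\<theta> \<in> top_dual \<Longrightarrow> Z_degree \<theta> 0 \<subseteq> Z_one_perp"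
  unfolding Z_degree_def Z_one_perp_span
  by (intro hull_mono image_mono) (auto simp: count_list_0_iff in_lists_conv_set)

text \<open>The sum is asserted for all large \<open>M\<close>, which allows two decompositions to be added.\<close>

lemma Z_dual_degree_decomposition:
  assumes "\<theta> \<in> top_dual" "\<theta> 1 = 1" "f \<in> Z_dual"
  shows "\<exists>F N. (\<forall>k. F k \<in> Z_degree \<theta> k) \<and> (\<forall>M\<ge>N. f = fam_sum F {..M})"
proof -
  note D = linear_subspaceD[OF Z_degree_subspace[OF assms(1)]]
  have "zword ` lists (letters \<theta>) \<subseteq> AM" using assms by (intro zwords_AM) auto
  with assms(3)[unfolded Z_dual_letters[OF assms(1,2)]] show ?thesis
  proof (induction rule: span_induct)
    case zero
    have "fam_zero = fam_sum (\<lambda>k. fam_zero) {..M}" for M :: nat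
      by (rule Fam_eqI) (auto simp: fam_entry fam_sum_entry)
    then show ?case using D(3) by (intro exI[of _ "\<lambda>_. fam_zero"]) auto
  next
    case (add f g)
    then obtain F N G N' where F: "\<forall>k. F k \<in> Z_degree \<theta> k" "\<forall>M\<ge>N. f = fam_sum F {..M}"
      and G: "\<forall>k. G k \<in> Z_degree \<theta> k" "\<forall>M\<ge>N'. g = fam_sum G {..M}" by blast
    have "F k \<in> Fam" "G k \<in> Fam" for k
      using D(2)[OF F(1)[rule_format]] D(2)[OF G(1)[rule_format]] .
    then have "fam_add (fam_sum F {..M}) (fam_sum G {..M}) = fam_sum (\<lambda>k. fam_add (F k) (G k)) {..M}"
      for M
      by (intro Fam_eqI) (auto simp: fam_entry fam_sum_entry sum.distrib)
    then have "\<forall>M\<ge>max N N'. fam_add f g = fam_sum (\<lambda>k. fam_add (F k) (G k)) {..M}"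
      using F(2) G(2) by (metis max.bounded_iff)
    moreover have "\<forall>k. fam_add (F k) (G k) \<in> Z_degree \<theta> k" using F(1) G(1) D(4) by blast
    ultimately show ?case
      by (intro exI[of _ "\<lambda>k. fam_add (F k) (G k)"] exI[of _ "max N N'"] conjI)
  next
    case (smult c f)
    then obtain F N where F: "\<forall>k. F k \<in> Z_degree \<theta> k" "\<forall>M\<ge>N. f = fam_sum F {..M}" by blast
    have "F k \<in> Fam" for k using D(2)[OF F(1)[rule_format]] .
    then have "fam_smult c (fam_sum F {..M}) = fam_sum (\<lambda>k. fam_smult c (F k)) {..M}" for M
      by (intro Fam_eqI) (auto simp: fam_entry fam_sum_entry sum_distrib_left)
    then have "\<forall>M\<ge>N. fam_smult c f = fam_sum (\<lambda>k. fam_smult c (F k)) {..M}"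
      using F(2) by metis
    moreover have "\<forall>k. fam_smult c (F k) \<in> Z_degree \<theta> k" using F(1) D(5) by blast
    ultimately show ?case
      by (intro exI[of _ "\<lambda>k. fam_smult c (F k)"] exI[of _ N] conjI)
  next
    case (base f)
    then obtain w where w: "w \<in> lists (letters \<theta>)" "f = zword w" by auto
    let ?F = "\<lambda>k. if k = count_list w \<theta> then zword w else fam_zero"
    have "zword w = fam_sum ?F {..M}" if "M \<ge> count_list w \<theta>" for M
      using that by (intro Fam_eqI) (auto simp: fam_entry fam_sum_entry if_distribR
        if_distrib[of "\<lambda>A. A $$ _"] cong: if_cong)
    moreover have "zword w \<in> Z_degree \<theta> (count_list w \<theta>)"
      using w unfolding Z_degree_def by (intro hull_inc imageI) auto
    ultimately show ?case using w D(3) by (intro exI[of _ ?F] exI[of _ "count_list w \<theta>"]) auto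
  qed
qed

text \<open>The linear map of \<open>B\<close> whose adjoint multiplies \<open>\<theta>\<close> by \<open>t\<close> and fixes \<open>1\<^sup>\<bottom>\<close>, provided that
  \<open>\<theta>(1) = 1\<close>.\<close>

definition dilation where "dilation \<theta> t b = b + ((t - 1) * \<theta> b) *\<^sub>C 1"

text \<open>Homogeneity of degree \<open>k\<close> under the dilations is a condition on the values of \<open>f\<close> alone, so it
  separates the degrees without any knowledge of linear relations between words.\<close>

definition homogeneous where
  "homogeneous \<theta> k f \<longleftrightarrow> f \<in> Fam \<and>
    (\<forall>t. \<forall>n\<ge>1. \<forall>\<beta>\<in>carrier_mat n n. \<forall>i<n. \<forall>j<n.
      f n (map_mat (dilation \<theta> t) \<beta>) $$ (i, j) = t ^ k * f n \<beta> $$ (i, j))"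

lemma homogeneous_zword:
  assumes "\<theta> \<in> top_dual" "\<theta> 1 = 1" "set w \<subseteq> letters \<theta>"
  shows "homogeneous \<theta> (count_list w \<theta>) (zword w)"
  unfolding homogeneous_def
proof (intro conjI allI impI ballI)
  fix t n i j and \<beta> :: "'a mat"
  assume *: "n \<ge> 1" "\<beta> \<in> carrier_mat n n" "i < n" "j < n"
  show "zword w n (map_mat (dilation \<theta> t) \<beta>) $$ (i, j) = t ^ count_list w \<theta> * zword w n \<beta> $$ (i, j)"
    using assms(3) *(3)
  proof (induction w arbitrary: i)
    case Nil
    then show ?case using * by (simp add: fam_entry)
  next
    case (Cons \<phi> w)
    have "\<phi> \<in> top_dual" "\<phi> = \<theta> \<or> \<phi> 1 = 0" using Cons assms by auto
    then have "\<phi> (dilation \<theta> t b) = (if \<phi> = \<theta> then t else 1) * \<phi> b" for b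
      using assms by (auto simp: dilation_def top_dualD algebra_simps)
    then show ?case using * Cons by (simp add: fam_entry sum_distrib_left mult_ac)
  qed
qed simp

lemma homogeneous_lin:
  "homogeneous \<theta> k fam_zero"
  "homogeneous \<theta> k f \<Longrightarrow> homogeneous \<theta> k g \<Longrightarrow> homogeneous \<theta> k (fam_add f g)"
  "homogeneous \<theta> k f \<Longrightarrow> homogeneous \<theta> k (fam_smult c f)"
  "(\<And>x. x \<in> I \<Longrightarrow> homogeneous \<theta> k (F x)) \<Longrightarrow> homogeneous \<theta> k (fam_sum F I)"
  by (auto simp: homogeneous_def fam_entry fam_sum_entry algebra_simps sum_distrib_left
    intro!: sum.cong)

lemma C_op_Fam [simp]: "C_op \<theta> f \<in> Fam"
  by (simp add: C_op_def Dstar_def)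

lemma C_op_lin:
  "C_op \<theta> fam_zero = fam_zero"
  "f \<in> Z_dual \<Longrightarrow> g \<in> Z_dual \<Longrightarrow> C_op \<theta> (fam_add f g) = fam_add (C_op \<theta> f) (C_op \<theta> g)"
  "f \<in> Z_dual \<Longrightarrow> C_op \<theta> (fam_smult c f) = fam_smult c (C_op \<theta> f)"
  by (simp_all add: C_op_def Dstar_def cyc_deriv_zero cyc_deriv_add cyc_deriv_smult
    fam_mult_zero fam_mult_distrib fam_mult_smult)

lemma C_op_sum:
  assumes "finite I" "\<And>x. x \<in> I \<Longrightarrow> F x \<in> Z_dual"
  shows "C_op \<theta> (fam_sum F I) = fam_sum (\<lambda>x. C_op \<theta> (F x)) I"
  using assms
proof (induction I rule: finite_induct)
  case (insert x I)
  then have "fam_sum F I \<in> Z_dual" by (intro fam_sum_in[OF Z_dual_subspace]) auto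
  then show ?case using insert by (simp add: fam_sum_insert Z_dualD(2) C_op_lin)
qed (simp add: fam_sum_empty C_op_lin)

lemma C_op_zword:
  assumes "set w \<subseteq> top_dual"
  shows "C_op \<theta> (zword w) =
    fam_sum (\<lambda>i. fam_smult ((w ! i) 1) (zword (drop (Suc i) w @ take i w @ [\<theta>]))) {..<length w}"
proof -
  have "fam_mult (fam_sum (\<lambda>i. fam_smult ((w ! i) 1) (zword (drop (Suc i) w @ take i w))) {..<length w}) (zfam \<theta>)
    = fam_sum (\<lambda>i. fam_smult ((w ! i) 1) (fam_mult (zword (drop (Suc i) w @ take i w)) (zfam \<theta>))) {..<length w}"
    by (rule Fam_eqI; simp add: fam_entry fam_sum_entry sum_distrib_left sum_distrib_right mult_ac)
      (rule sum.swap)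
  also have "\<dots> = fam_sum (\<lambda>i. fam_smult ((w ! i) 1) (zword (drop (Suc i) w @ take i w @ [\<theta>]))) {..<length w}"
    by (simp add: zword_append fam_mult_one fam_mult_assoc)
  finally show ?thesis using assms by (simp add: C_op_def Dstar_def cyc_deriv_zword)
qed

lemma count_list_split:
  assumes "i < length w"
  shows "count_list w x = count_list (take i w) x + (if w ! i = x then 1 else 0) + count_list (drop (Suc i) w) x"
  by (subst id_take_nth_drop[OF assms]) (simp add: count_list_append)

lemma C_op_homogeneous:
  assumes "\<theta> \<in> top_dual" "\<theta> 1 = 1" "f \<in> Z_degree \<theta> k"
  shows "homogeneous \<theta> k (C_op \<theta> f)"
proof -
  have sub: "f \<in> Z_dual" if "f \<in> Z_degree \<theta> k" for f
    using that Z_degree_subset[OF assms(1,2)] by auto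
  show ?thesis using assms(3,1)
  proof (induction rule: Z_degree_induct)
    case (word w)
    have "homogeneous \<theta> k (fam_smult ((w ! i) 1) (zword (drop (Suc i) w @ take i w @ [\<theta>])))"
      if i: "i < length w" for i
    proof (cases "w ! i = \<theta>")
      case True
      have "set (drop (Suc i) w @ take i w @ [\<theta>]) \<subseteq> letters \<theta>"
        using word by (auto dest: in_set_dropD in_set_takeD)
      note homogeneous_zword[OF assms(1,2) this]
      moreover have "count_list (drop (Suc i) w @ take i w @ [\<theta>]) \<theta> = k"
        using word(2) count_list_split[OF i, of \<theta>] True by (simp add: count_list_append)
      ultimately show ?thesis by (simp add: homogeneous_lin)
    next
      case False
      then have "(w ! i) 1 = 0" using word(1) nth_mem[OF i] by auto
      then have "fam_smult ((w ! i) 1) (zword (drop (Suc i) w @ take i w @ [\<theta>])) = fam_zero"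
        by (intro Fam_eqI) (auto simp: fam_entry)
      then show ?thesis by (simp add: homogeneous_lin)
    qed
    moreover have "set w \<subseteq> top_dual" using word assms by auto
    ultimately show ?case by (auto simp: C_op_zword intro!: homogeneous_lin(4))
  qed (simp_all add: C_op_lin homogeneous_lin sub)
qed

lemma sum_word_at_1:
  assumes "\<theta> 1 = 1" "set w \<subseteq> letters \<theta>"
  shows "(\<Sum>i<length w. (w ! i) 1) = of_nat (count_list w \<theta>)"
  using assms by (induction w) (auto simp: sum.lessThan_Suc_shift simp del: sum.lessThan_Suc)

text \<open>On a word \<open>w = uv\<close> with \<open>u\<close> ending in \<open>\<theta>\<close>, the summand \<open>vu\<close> of \<open>C\<^sub>\<theta> w\<close> differs from \<open>w\<close> by a
  commutator, and there are \<open>k\<close> such factorizations.\<close>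

lemma C_op_mod_commutators:
  assumes "\<theta> \<in> top_dual" "\<theta> 1 = 1" "f \<in> Z_degree \<theta> k"
  shows "fam_diff (C_op \<theta> f) (fam_smult (of_nat k) f) \<in> commutator_span Z_dual"
proof -
  note D = linear_subspaceD[OF commutator_span_subspace]
  have sub: "f \<in> Z_dual" "f \<in> Fam" if "f \<in> Z_degree \<theta> k" for f
    using that Z_degree_subset[OF assms(1,2)] Z_dualD(2) by auto
  show ?thesis using assms(3,1)
  proof (induction rule: Z_degree_induct)
    case zero
    have "fam_diff (C_op \<theta> fam_zero) (fam_smult (of_nat k) fam_zero) = fam_zero"
      by (rule Fam_eqI) (auto simp: fam_entry C_op_lin)
    then show ?case using D(3) by simp
  next
    case (add f g)
    have "fam_diff (C_op \<theta> (fam_add f g)) (fam_smult (of_nat k) (fam_add f g)) =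
      fam_add (fam_diff (C_op \<theta> f) (fam_smult (of_nat k) f)) (fam_diff (C_op \<theta> g) (fam_smult (of_nat k) g))"
      using sub add by (intro Fam_eqI) (auto simp: fam_entry C_op_lin algebra_simps)
    then show ?case using D(4) add by simp
  next
    case (smult c f)
    have "fam_diff (C_op \<theta> (fam_smult c f)) (fam_smult (of_nat k) (fam_smult c f)) =
      fam_smult c (fam_diff (C_op \<theta> f) (fam_smult (of_nat k) f))"
      using sub smult by (intro Fam_eqI) (auto simp: fam_entry C_op_lin algebra_simps)
    then show ?case using D(5) smult by simp
  next
    case (word w)
    have w: "set w \<subseteq> top_dual" using word assms by auto
    have "fam_diff (C_op \<theta> (zword w)) (fam_smult (of_nat k) (zword w)) =
      fam_sum (\<lambda>i. fam_smult ((w ! i) 1)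
        (fam_diff (zword (drop (Suc i) w @ take i w @ [\<theta>])) (zword w))) {..<length w}"
      using sum_word_at_1[OF assms(2) word(1)] word(2)
      by (intro Fam_eqI) (auto simp: C_op_zword[OF w] fam_entry fam_sum_entry right_diff_distrib
        sum_subtractf sum_distrib_right[symmetric])
    also have "\<dots> \<in> commutator_span Z_dual"
    proof (rule fam_sum_in[OF commutator_span_subspace])
      fix i assume i: "i \<in> {..<length w}"
      show "fam_smult ((w ! i) 1) (fam_diff (zword (drop (Suc i) w @ take i w @ [\<theta>])) (zword w))
        \<in> commutator_span Z_dual"
      proof (cases "w ! i = \<theta>")
        case True
        define u v where "u = take i w @ [\<theta>]" and "v = drop (Suc i) w"
        have "w = u @ v" using i True id_take_nth_drop[of i w] by (simp add: u_def v_def)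
        have "zword u \<in> Z_dual" "zword v \<in> Z_dual"
          using w assms(1) by (auto simp: u_def v_def intro!: zword_Z_dual dest!: in_set_dropD in_set_takeD)
        then have "fam_diff (fam_mult (zword v) (zword u)) (fam_mult (zword u) (zword v)) \<in> commutator_span Z_dual"
          unfolding commutator_span_def by (intro hull_inc) auto
        then have "fam_diff (zword (v @ u)) (zword w) \<in> commutator_span Z_dual"
          unfolding \<open>w = u @ v\<close> by (simp add: zword_append)
        then show ?thesis by (intro D(5)) (simp add: u_def v_def)
      next
        case False
        then have "(w ! i) 1 = 0" using word(1) i nth_mem[of i w] by fastforce
        then have "fam_smult ((w ! i) 1) (fam_diff (zword (drop (Suc i) w @ take i w @ [\<theta>])) (zword w))
            = fam_zero"
          by (intro Fam_eqI) (auto simp: fam_entry)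
        then show ?thesis using D(3) by simp
      qed
    qed simp
    finally show ?case .
  qed
qed

section \<open>The kernel of \<open>C\<^sub>\<theta>\<close>\<close>

lemma ker_C_op_subset:
  assumes "\<theta> \<in> top_dual" "\<theta> 1 = 1"
  shows "ker_on (C_op \<theta>) Z_dual \<subseteq> subspace_sum Z_one_perp (commutator_span Z_dual)"
proof
  fix f assume "f \<in> ker_on (C_op \<theta>) Z_dual"
  then have f: "f \<in> Z_dual" "C_op \<theta> f = fam_zero" by (auto simp: ker_on_def)
  obtain F N where F: "\<And>k. F k \<in> Z_degree \<theta> k" "f = fam_sum F {..N}"
    using Z_dual_degree_decomposition[OF assms f(1)] by blast
  have FZ: "F k \<in> Z_dual" "F k \<in> Fam" for k
    using F(1) Z_degree_subset[OF assms] Z_dualD(2) by auto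
  note D = linear_subspaceD[OF commutator_span_subspace]
  have zero: "C_op \<theta> (F k) = fam_zero" if k: "k \<le> N" for k
  proof (rule Fam_eqI)
    fix n i j and \<beta> :: "'a mat"
    assume *: "n \<ge> 1" "\<beta> \<in> carrier_mat n n" "i < n" "j < n"
    \<comment> \<open>This polynomial in \<open>t\<close> is an entry of \<open>C\<^sub>\<theta> f\<close> at the dilated matrix.\<close>
    have "(\<Sum>k\<le>N. C_op \<theta> (F k) n \<beta> $$ (i, j) * t ^ k) = 0" for t
    proof -
      have c: "map_mat (dilation \<theta> t) \<beta> \<in> carrier_mat n n" using * by simp
      have "(\<Sum>k\<le>N. C_op \<theta> (F k) n \<beta> $$ (i, j) * t ^ k) =
          (\<Sum>k\<le>N. C_op \<theta> (F k) n (map_mat (dilation \<theta> t) \<beta>) $$ (i, j))"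
        using * C_op_homogeneous[OF assms F(1)] by (simp add: homogeneous_def mult.commute)
      also have "\<dots> = C_op \<theta> f n (map_mat (dilation \<theta> t) \<beta>) $$ (i, j)"
        unfolding F(2) using * c FZ by (subst C_op_sum) (auto simp: fam_sum_entry)
      also have "\<dots> = 0" using f(2) * c by (simp add: fam_entry)
      finally show ?thesis .
    qed
    then have "C_op \<theta> (F k) n \<beta> $$ (i, j) = 0"
      using k polyfun_eq_0[of "\<lambda>k. C_op \<theta> (F k) n \<beta> $$ (i, j)" N] by simp
    then show "C_op \<theta> (F k) n \<beta> $$ (i, j) = fam_zero n \<beta> $$ (i, j)" using * by (simp add: fam_entry)
  qed auto
  have "F k \<in> commutator_span Z_dual" if k: "k \<in> {1..N}" for k
  proof -
    have "fam_smult (- 1 / of_nat k) (fam_diff (C_op \<theta> (F k)) (fam_smult (of_nat k) (F k)))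
        \<in> commutator_span Z_dual"
      by (intro D(5) C_op_mod_commutators assms F)
    also have "fam_smult (- 1 / of_nat k) (fam_diff (C_op \<theta> (F k)) (fam_smult (of_nat k) (F k))) = F k"
      using k FZ zero[of k] by (intro Fam_eqI) (auto simp: fam_entry)
    finally show ?thesis .
  qed
  then have "fam_sum F {1..N} \<in> commutator_span Z_dual"
    by (intro fam_sum_in[OF commutator_span_subspace]) auto
  moreover have "{..N} = insert 0 {1..N}" by auto
  then have "f = fam_add (F 0) (fam_sum F {1..N})"
    using F(2) FZ by (simp add: fam_sum_insert)
  moreover have "F 0 \<in> Z_one_perp" using F(1) Z_degree_0[OF assms(1)] by auto
  ultimately show "f \<in> subspace_sum Z_one_perp (commutator_span Z_dual)"
    unfolding subspace_sum_def by blast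
qed

theorem corollary8p4:
  fixes \<theta> :: "'b::complex_unital_banach_algebra \<Rightarrow> complex"
  assumes "\<theta> \<in> top_dual" and "\<theta> 1 = 1"
  shows "ker_on cyc_deriv Z_dual = ker_on (C_op \<theta>) Z_dual \<and>
         ker_on (C_op \<theta>) Z_dual =
           subspace_sum (Z_one_perp :: 'b family set) (commutator_span Z_dual)"
proof -
  have "ker_on cyc_deriv Z_dual \<subseteq> ker_on (C_op \<theta>) Z_dual"
    by (auto simp: ker_on_def C_op_def Dstar_def fam_mult_zero)
  moreover have "subspace_sum Z_one_perp (commutator_span Z_dual) \<subseteq> ker_on cyc_deriv (Z_dual :: 'b family set)"
    using Z_one_perp_subset_ker commutator_span_subset_ker linear_subspaceD(4)[OF ker_cyc_deriv_subspace]
    unfolding subspace_sum_def by blast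
  ultimately show ?thesis using ker_C_op_subset[OF assms] by blast
qed

end
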